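(* Let $n\ge 1$, let $m\ge 3$ be an odd integer, and let $C_n(\mathbb{R}^m)=\{(x_1,\dots,x_n)\in(\mathbb{R}^m)^n : x_i\neq x_j \text{ for } i\neq j\}$ be the configuration space of $n$ ordered distinct points in $\mathbb{R}^m$. Then $\mathbf{TC}(C_n(\mathbb{R}^m))=2n-1$.
   Context: For a connected CW complex (or space of that homotopy type) $X$, let $PX$ be the space of all continuous paths $\gamma:[0,1]\to X$ with the compact-open topology, and let $\pi:PX\to X\times X$, $\pi(\gamma)=(\gamma(0),\gamma(1))$. The topological complexity $\mathbf{TC}(X)$ is the smallest number $k$ such that $X\times X$ can be covered by $k$ open sets $U_1,\dots,U_k$ such that for every $i=1,\dots,k$ there is a continuous map $s_i:U_i\to PX$ with $\pi\circ s_i=\mathrm{id}_{U_i}$. (This is the unreduced normalization: $\mathbf{TC}$ of a contractible space is $1$.) *)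

theory Defs
  imports "HOL-Analysis.Analysis" "HOL-Library.Extended_Nat"
begin

(* Extensionality on topspace X makes the elements correspond exactly to the
   continuous maps X -> Y (HOL functions are total on the type). *)
definition mapping_set :: "'a topology \<Rightarrow> 'b topology \<Rightarrow> ('a \<Rightarrow> 'b) set" where
  "mapping_set X Y = {f. continuous_map X Y f \<and> f \<in> extensional (topspace X)}"

definition compact_open_topology :: "'a topology \<Rightarrow> 'b topology \<Rightarrow> ('a \<Rightarrow> 'b) topology" where
  "compact_open_topology X Y =
     topology_generated_by
       {{f \<in> mapping_set X Y. f ` K \<subseteq> V} | K V. compactin X K \<and> openin Y V}"

lemma topspace_compact_open_topology [simp]:
  "topspace (compact_open_topology X Y) = mapping_set X Y"
proof -
  have "mapping_set X Y \<in> {{f \<in> mapping_set X Y. f ` K \<subseteq> V} | K V. compactin X K \<and> openin Y V}"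
    by (auto intro!: exI[of _ "{}"])
  then show ?thesis
    unfolding compact_open_topology_def topology_generated_by_topspace by blast
qed

definition path_space :: "'a topology \<Rightarrow> (real \<Rightarrow> 'a) topology" where
  "path_space X = compact_open_topology (top_of_set {0..1}) X"

definition path_ends :: "(real \<Rightarrow> 'a) \<Rightarrow> 'a \<times> 'a" where
  "path_ends g = (g 0, g 1)"

definition local_motion_planner ::
    "'a topology \<Rightarrow> ('a \<times> 'a) set \<Rightarrow> ('a \<times> 'a \<Rightarrow> real \<Rightarrow> 'a) \<Rightarrow> bool" where
  "local_motion_planner X U s \<longleftrightarrow>
     continuous_map (subtopology (prod_topology X X) U) (path_space X) s \<and>
     (\<forall>p\<in>U. path_ends (s p) = p)"

definition motion_planning_cover :: "'a topology \<Rightarrow> nat \<Rightarrow> bool" where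
  "motion_planning_cover X k \<longleftrightarrow>
     (\<exists>U :: nat \<Rightarrow> ('a \<times> 'a) set.
        (\<forall>i\<in>{1..k}. openin (prod_topology X X) (U i) \<and> (\<exists>s. local_motion_planner X (U i) s)) \<and>
        (\<Union>i\<in>{1..k}. U i) = topspace (prod_topology X X))"

(* Unreduced normalization; the value is infinite when no finite cover exists. *)
definition topological_complexity :: "'a topology \<Rightarrow> enat" where
  "topological_complexity X = (INF k\<in>{k. motion_planning_cover X k}. enat k)"

definition configuration_space :: "nat \<Rightarrow> 'a topology \<Rightarrow> (nat \<Rightarrow> 'a) topology" where
  "configuration_space n X =
     subtopology (product_topology (\<lambda>_. X) {1..n})
       {x. \<forall>i\<in>{1..n}. \<forall>j\<in>{1..n}. i \<noteq> j \<longrightarrow> x i \<noteq> x j}"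

end

theory Submission
  imports Defs "HOL-Homology.Brouwer_Degree"
begin

text \<open>Lower bound.  Write \<open>N = n - 1\<close>.  Placing the points at exponentially growing distances
  from the first one makes the product of \<open>N\<close> spheres of even dimension \<open>m - 1\<close> a retract of the
  configuration space.  Given \<open>2 N\<close> local planners, two of them are assigned to each
  factor \<open>j\<close>; following planner \<open>i\<close> up to a cut-off deforms the first projection
  \<open>x\<^sub>j\<close> to a map \<open>a\<^sub>i\<close> that equals the second projection \<open>y\<^sub>j\<close> on a set \<open>C\<^sub>i\<close>, and the \<open>C\<^sub>i\<close>
  cover everything.  But a degree argument yields a point at which all \<open>a\<^sub>i\<close> equal \<open>- y\<^sub>j\<close>: up to
  homotopy the system of these equations is, in each factor, the double-angle map
  \<open>(\<mu>, x) \<mapsto> (\<mu>\<^sup>2 - |x|\<^sup>2, \<mu> x)\<close> of \<open>\<real>\<^bsup>m+1\<^esup>\<close> times an identity, and this has degree 2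
  because \<open>m + 1\<close> is even.  So the total degree is \<open>2\<^sup>N\<close>, which does not vanish.

  Upper bound.  Group the points of both configurations by their first coordinates: a pair of equivalence relations
  determines an open cell, on which coordinate differences within classes are smaller than those
  between classes.  Cells with equally many classes in total are disjoint, so the
  possible totals 2, ..., 2n give \<open>2 n - 1\<close> open sets.  On a cell the first coordinates can be moved to
  fixed distinct values, which reduces planning to five straight segments.\<close>

section \<open>Degrees of maps between spheres\<close>

text \<open>The homology of the sphere relative to the equator is the direct sum of the
  contributions of the two closed hemispheres, and measuring images modulo the contractible lower
  hemisphere loses nothing. Measured in this way \<open>g\<close> kills the lower summand and
  \<open>h\<close> the upper one, so \<open>f\<close> acts as the sum of the two.\<close>

lemma Brouwer_degree2_hemisphere_additive:
  assumes k: "k \<le> p"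
    and f: "continuous_map (nsphere p) (nsphere p) f"
    and g: "continuous_map (nsphere p) (nsphere p) g"
    and h: "continuous_map (nsphere p) (nsphere p) h"
    and fg: "\<And>x. x k \<ge> 0 \<Longrightarrow> f x = g x"
    and fh: "\<And>x. x k \<le> 0 \<Longrightarrow> f x = h x"
    and gl: "g \<in> {x. x k \<le> 0} \<rightarrow> {x. x k \<le> 0}"
    and hu: "h \<in> {x. x k \<ge> 0} \<rightarrow> {x. x k \<le> 0}"
  shows "Brouwer_degree2 p f = Brouwer_degree2 p h + Brouwer_degree2 p g"
proof (rule Brouwer_degree2_unique [OF f])
  let ?X = "nsphere p" and ?G = "reduced_homology_group p (nsphere p)"
  define E where "E = {x::nat\<Rightarrow>real. x k = 0}"
  define L where "L = {x::nat\<Rightarrow>real. x k \<le> 0}"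
  define U where "U = {x::nat\<Rightarrow>real. x k \<ge> 0}"
  let ?R = "relative_homology_group p ?X"
  let ?Ls = "subtopology ?X L" and ?Us = "subtopology ?X U"
  let ?RL = "relative_homology_group p ?Ls E"
  let ?RU = "relative_homology_group p ?Us E"
  let ?iL = "hom_induced p ?Ls E ?X E id"
  let ?iU = "hom_induced p ?Us E ?X E id"
  let ?J = "hom_induced p ?X {} ?X E id"
  let ?pi = "hom_induced p ?X {} ?X L id"
  let ?F = "\<lambda>f. hom_induced p ?X E ?X L f"
  have EL: "E \<subseteq> L" "E \<subseteq> U" by (auto simp: E_def L_def U_def)
  have fE: "f \<in> E \<rightarrow> L" "g \<in> E \<rightarrow> L" "h \<in> E \<rightarrow> L"
    using gl hu fg unfolding E_def L_def by fastforce+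
  \<comment> \<open>By excision each hemisphere relative to the equator is the sphere relative to
    the opposite hemisphere. Together with two exact sequences of triples this gives the
    splitting.\<close>
  have iso: "(\<lambda>(x, y). ?iL x \<otimes>\<^bsub>?R E\<^esub> ?iU y) \<in> Group.iso (?RL \<times>\<times> ?RU) (?R E)"
  proof (rule conjunct1 [OF exact_sequence_sum_lemma [OF abelian_relative_homology_group]])
    show "hom_induced p ?Ls E ?X U id \<in> Group.iso ?RL (?R U)"
      unfolding E_def L_def U_def using iso_relative_homology_group_lower_hemisphere by blast
    show "hom_induced p ?Us E ?X L id \<in> Group.iso ?RU (?R L)"
      unfolding E_def L_def U_def using iso_relative_homology_group_upper_hemisphere by blast
    show "exact_seq ([?R L, ?R E, ?RL], [hom_induced p ?X E ?X L id, ?iL])"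
      using EL by (intro homology_exactness_triple_3)
    show "exact_seq ([?R U, ?R E, ?RU], [hom_induced p ?X E ?X U id, ?iU])"
      using EL by (intro homology_exactness_triple_3)
  qed (use EL in \<open>simp_all add: hom_induced_compose' subset_iff continuous_map_from_subtopology\<close>)
  interpret RE: comm_group "?R E" by simp
  interpret RLg: comm_group "?R L" by simp
  interpret G: group ?G by simp
  have pi_iso: "?pi \<in> Group.iso ?G (?R L)"
    unfolding L_def using iso_reduced_homology_group_lower_hemisphere [OF k] .
  then interpret pi: group_hom ?G "?R L" ?pi
    by (simp add: group_hom_def group_hom_axioms_def iso_def)
  have pi_inj: "inj_on ?pi (carrier ?G)"
    using pi_iso by (simp add: iso_iff)
  fix c assume c: "c \<in> carrier ?G"
  have "?J c \<in> carrier (?R E)"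
    by (simp add: hom_induced_carrier)
  with iso obtain a b where a: "a \<in> carrier ?RL" and b: "b \<in> carrier ?RU"
      and Jc: "?J c = ?iL a \<otimes>\<^bsub>?R E\<^esub> ?iU b"
  proof -
    have "?J c \<in> (\<lambda>(x, y). ?iL x \<otimes>\<^bsub>?R E\<^esub> ?iU y) ` carrier (?RL \<times>\<times> ?RU)"
      using iso \<open>?J c \<in> carrier (?R E)\<close> by (simp add: iso_iff del: carrier_DirProd)
    then show thesis
      using that by (elim imageE) (auto simp: DirProd_def)
  qed
  have split: "?pi (hom_induced p ?X {} ?X {} q c)
       = hom_induced p ?Ls E ?X L q a \<otimes>\<^bsub>?R L\<^esub> hom_induced p ?Us E ?X L q b"
    if q: "continuous_map ?X ?X q" "q \<in> E \<rightarrow> L" for q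
  proof -
    interpret F: group_hom "?R E" "?R L" "?F q"
      by (simp add: group_hom_axioms_def group_hom_def hom_induced_hom)
    have "?pi (hom_induced p ?X {} ?X {} q c) = ?F q (?J c)"
      using q by (simp add: hom_induced_compose')
    also have "\<dots> = ?F q (?iL a) \<otimes>\<^bsub>?R L\<^esub> ?F q (?iU b)"
      unfolding Jc by (rule F.hom_mult) (simp_all add: hom_induced_carrier)
    also have "\<dots> = hom_induced p ?Ls E ?X L q a \<otimes>\<^bsub>?R L\<^esub> hom_induced p ?Us E ?X L q b"
      using q by (simp add: hom_induced_compose' continuous_map_from_subtopology)
    finally show ?thesis .
  qed
  \<comment> \<open>A map carrying the hemisphere \<open>S\<close> into \<open>L\<close> factors
    through the homology of the pair \<open>(S, S)\<close>, which is zero.\<close>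
  have triv: "hom_induced p (subtopology ?X S) E ?X L q d = \<one>\<^bsub>?R L\<^esub>"
    if q: "continuous_map ?X ?X q" "q \<in> S \<rightarrow> L" and "E \<subseteq> S"
      and d: "d \<in> carrier (relative_homology_group p (subtopology ?X S) E)" for q S d
  proof -
    let ?S = "subtopology ?X S"
    interpret F: group_hom "relative_homology_group p ?S S" "?R L" "hom_induced p ?S S ?X L q"
      by (simp add: group_hom_axioms_def group_hom_def hom_induced_hom)
    have tr: "trivial_group (relative_homology_group p ?S S)"
      by (metis relative_homology_group_restrict trivial_relative_homology_group_topspace
          topspace_subtopology inf.commute inf.left_idem)
    have "hom_induced p ?S E ?X L q d = hom_induced p ?S S ?X L q (hom_induced p ?S E ?S S id d)"
      using that by (subst hom_induced_compose') (auto simp: continuous_map_from_subtopology)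
    also have "hom_induced p ?S E ?S S id d = \<one>\<^bsub>relative_homology_group p ?S S\<^esub>"
      using tr hom_induced_carrier by (metis singletonD trivial_group_def)
    finally show ?thesis using F.hom_one by argo
  qed
  let ?h = "\<lambda>q. hom_induced p ?X {} ?X {} q c"
  have "?pi (?h f) = hom_induced p ?Ls E ?X L h a \<otimes>\<^bsub>?R L\<^esub> hom_induced p ?Us E ?X L g b"
  proof -
    have "hom_induced p ?Ls E ?X L f = hom_induced p ?Ls E ?X L h"
      by (rule hom_induced_eq) (use fh in \<open>auto simp: L_def\<close>)
    moreover have "hom_induced p ?Us E ?X L f = hom_induced p ?Us E ?X L g"
      by (rule hom_induced_eq) (use fg in \<open>auto simp: U_def\<close>)
    ultimately show ?thesis using split [OF f fE(1)] by simp
  qed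
  moreover have "?pi (?h g) = hom_induced p ?Us E ?X L g b"
    using split [OF g fE(2)] triv [OF g _ EL(1) a] gl RLg.l_one hom_induced_carrier
    unfolding L_def [symmetric] by metis
  moreover have "?pi (?h h) = hom_induced p ?Ls E ?X L h a"
    using split [OF h fE(3)] triv [OF h _ EL(2) b] hu RLg.r_one hom_induced_carrier
    unfolding L_def [symmetric] U_def [symmetric] by metis
  ultimately have "?pi (?h f) = ?pi (?h h \<otimes>\<^bsub>?G\<^esub> ?h g)"
    using c by (simp add: hom_induced_reduced)
  then have "?h f = ?h h \<otimes>\<^bsub>?G\<^esub> ?h g"
    by (rule inj_onD [OF pi_inj]) (use c in \<open>simp_all add: hom_induced_reduced\<close>)
  then show "?h f = c [^]\<^bsub>?G\<^esub> (Brouwer_degree2 p h + Brouwer_degree2 p g)"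
    using c by (simp add: Brouwer_degree2 G.int_pow_mult)
qed

section \<open>Sphere maps obtained by normalisation\<close>

definition unit_sphere :: "nat \<Rightarrow> (nat \<Rightarrow> real) set" where
  "unit_sphere p = {x. (\<Sum>i\<le>p. (x i)\<^sup>2) = 1 \<and> (\<forall>i>p. x i = 0)}"

lemma nsphere_eq_top_of_set: "nsphere p = top_of_set (unit_sphere p)"
  by (simp add: nsphere unit_sphere_def euclidean_product_topology)

lemma continuous_map_nsphere_iff:
  "continuous_map (nsphere p) (nsphere p) f \<longleftrightarrow>
     continuous_on (unit_sphere p) f \<and> f \<in> unit_sphere p \<rightarrow> unit_sphere p"
  by (simp add: nsphere_eq_top_of_set image_subset_iff_funcset)

definition radial :: "nat \<Rightarrow> (nat \<Rightarrow> real) \<Rightarrow> nat \<Rightarrow> real" where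
  "radial p v = (\<lambda>i. if i \<le> p then v i / sqrt (\<Sum>i\<le>p. (v i)\<^sup>2) else 0)"

lemma sum_squares_pos:
  fixes v :: "nat \<Rightarrow> real"
  assumes "i \<le> p" "v i \<noteq> 0"
  shows "(\<Sum>i\<le>p. (v i)\<^sup>2) > 0"
  using assms by (intro sum_pos2 [of _ i]) auto

lemma radial_in_unit_sphere:
  assumes "\<exists>i\<le>p. v i \<noteq> 0"
  shows "radial p v \<in> unit_sphere p"
proof -
  have "(\<Sum>i\<le>p. (v i)\<^sup>2) > 0" using assms sum_squares_pos by blast
  then show ?thesis
    by (simp add: unit_sphere_def radial_def power_divide flip: sum_divide_distrib)
qed

lemma radial_unit_sphere: "x \<in> unit_sphere p \<Longrightarrow> radial p x = x"
  by (auto simp: radial_def unit_sphere_def fun_eq_iff)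

lemma unit_sphere_nonzero: "x \<in> unit_sphere p \<Longrightarrow> \<exists>i\<le>p. x i \<noteq> 0"
proof (rule ccontr)
  assume "x \<in> unit_sphere p" and "\<not> (\<exists>i\<le>p. x i \<noteq> 0)"
  then show False by (simp add: unit_sphere_def)
qed

lemma continuous_on_radial:
  assumes "\<And>i. i \<le> p \<Longrightarrow> continuous_on S (\<lambda>z. F z i)" and "\<And>z. z \<in> S \<Longrightarrow> \<exists>i\<le>p. F z i \<noteq> 0"
  shows "continuous_on S (\<lambda>z. radial p (F z))"
proof (rule continuous_on_coordinatewise_then_product)
  fix i
  have "sqrt (\<Sum>i\<le>p. (F z i)\<^sup>2) \<noteq> 0" if "z \<in> S" for z
    using assms(2) [OF that] sum_squares_pos [of _ p "F z"] by (metis less_irrefl real_sqrt_eq_0_iff)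
  then have "continuous_on S (\<lambda>z. F z i / sqrt (\<Sum>i\<le>p. (F z i)\<^sup>2))" if "i \<le> p"
    using assms(1) that by (intro continuous_intros) auto
  then show "continuous_on S (\<lambda>z. radial p (F z) i)"
    by (cases "i \<le> p") (simp_all add: radial_def)
qed

lemma continuous_map_radial:
  assumes "\<And>i. i \<le> p \<Longrightarrow> continuous_on (unit_sphere p) (\<lambda>z. F z i)"
    and "\<And>z. z \<in> unit_sphere p \<Longrightarrow> \<exists>i\<le>p. F z i \<noteq> 0"
  shows "continuous_map (nsphere p) (nsphere p) (\<lambda>z. radial p (F z))"
  unfolding continuous_map_nsphere_iff
  using continuous_on_radial [of p "unit_sphere p" F] assms radial_in_unit_sphere by auto

lemma degree_radial_homotopy:
  assumes c: "\<And>i. i \<le> p \<Longrightarrow> continuous_on ({0..1} \<times> unit_sphere p) (\<lambda>z. H (fst z) (snd z) i)"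
    and nz: "\<And>t x. \<lbrakk>0 \<le> t; t \<le> 1; x \<in> unit_sphere p\<rbrakk> \<Longrightarrow> \<exists>i\<le>p. H t x i \<noteq> 0"
  shows "Brouwer_degree2 p (\<lambda>x. radial p (H (0::real) x)) = Brouwer_degree2 p (\<lambda>x. radial p (H 1 x))"
proof (rule Brouwer_degree2_homotopic)
  have "continuous_on ({0..1} \<times> unit_sphere p) (\<lambda>z. radial p (H (fst z) (snd z)))"
    using c nz by (intro continuous_on_radial) auto
  moreover have "radial p (H t x) \<in> unit_sphere p" if "0 \<le> t" "t \<le> 1" "x \<in> unit_sphere p" for t x
    using nz [OF that] by (rule radial_in_unit_sphere)
  ultimately have "continuous_map (prod_topology (top_of_set {0..1}) (nsphere p)) (nsphere p)
      (\<lambda>z. radial p (H (fst z) (snd z)))"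
    unfolding nsphere_eq_top_of_set prod_topology_subtopology_eu
    by (force simp: image_subset_iff)
  then show "homotopic_with (\<lambda>x. True) (nsphere p) (nsphere p) (\<lambda>x. radial p (H 0 x)) (\<lambda>x. radial p (H 1 x))"
    unfolding homotopic_with_def by force
qed

lemma degree_radial_linear_homotopy:
  assumes F: "\<And>i. i \<le> p \<Longrightarrow> continuous_on (unit_sphere p) (\<lambda>x. F x i)"
    and G: "\<And>i. i \<le> p \<Longrightarrow> continuous_on (unit_sphere p) (\<lambda>x. G x i)"
    and nz: "\<And>t x. \<lbrakk>0 \<le> t; t \<le> 1; x \<in> unit_sphere p\<rbrakk> \<Longrightarrow> \<exists>i\<le>p. (1 - t) * F x i + t * G x i \<noteq> 0"
  shows "Brouwer_degree2 p (\<lambda>x. radial p (F x)) = Brouwer_degree2 p (\<lambda>x. radial p (G x))"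
proof -
  have "continuous_on ({0..1} \<times> unit_sphere p) (\<lambda>z. (1 - fst z) * F (snd z) i + fst z * G (snd z) i)"
    if "i \<le> p" for i
    by (intro continuous_intros continuous_on_compose2 [OF F [OF that]] continuous_on_compose2 [OF G [OF that]]) auto
  then show ?thesis
    using degree_radial_homotopy [of p "\<lambda>t x i. (1 - t) * F x i + t * G x i"] nz by simp
qed

text \<open>On the segment from \<open>F x\<close> to \<open>G x\<close> a coordinate in which
  \<open>F x\<close> is nonzero keeps its sign, so the segment avoids the origin. This permits
  rescaling every coordinate by its own positive factor.\<close>

lemma degree_radial_same_sign:
  assumes F: "\<And>i. i \<le> p \<Longrightarrow> continuous_on (unit_sphere p) (\<lambda>x. F x i)"
    and G: "\<And>i. i \<le> p \<Longrightarrow> continuous_on (unit_sphere p) (\<lambda>x. G x i)"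
    and nz: "\<And>x. x \<in> unit_sphere p \<Longrightarrow> \<exists>i\<le>p. F x i \<noteq> 0"
    and s: "\<And>x i. \<lbrakk>x \<in> unit_sphere p; i \<le> p\<rbrakk> \<Longrightarrow> sgn (F x i) = sgn (G x i)"
  shows "Brouwer_degree2 p (\<lambda>x. radial p (F x)) = Brouwer_degree2 p (\<lambda>x. radial p (G x))"
proof (rule degree_radial_linear_homotopy)
  fix t :: real and x assume t: "0 \<le> t" "t \<le> 1" and x: "x \<in> unit_sphere p"
  obtain i where i: "i \<le> p" "F x i \<noteq> 0" using nz [OF x] by blast
  have "(1 - t) * F x i + t * G x i \<noteq> 0"
  proof (cases "F x i > 0")
    case True
    then have "G x i > 0" using s [OF x i(1)] by (metis sgn_greater)
    then show ?thesis using True t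
      by (smt (verit) mult_nonneg_nonneg mult_pos_pos)
  next
    case False
    then have "F x i < 0" "G x i < 0" using i s [OF x i(1)] by (metis linorder_neqE_linordered_idom sgn_less)+
    then have "(1 - t) * (- F x i) + t * (- G x i) > 0" using t
      by (smt (verit) mult_nonneg_nonneg mult_pos_pos)
    then show ?thesis by simp
  qed
  then show "\<exists>i\<le>p. (1 - t) * F x i + t * G x i \<noteq> 0" using i by blast
qed (use F G in blast)+

text \<open>Shrinking the sphere of radius \<open>R\<close> to the origin is a homotopy to a
  constant map if no zero is met. Read contrapositively, a nonzero degree forces a zero in the
  ball.\<close>

lemma degree_radial_zero_free:
  assumes c: "\<And>i. i \<le> p \<Longrightarrow> continuous_on UNIV (\<lambda>x. F x i)"
    and nz: "\<And>t x. \<lbrakk>0 \<le> t; t \<le> 1; x \<in> unit_sphere p\<rbrakk> \<Longrightarrow> \<exists>i\<le>p. F (\<lambda>k. t * R * x k) i \<noteq> 0"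
  shows "Brouwer_degree2 p (\<lambda>x. radial p (F (\<lambda>k. R * x k))) = 0"
proof -
  have "continuous_on ({0..1} \<times> unit_sphere p) (\<lambda>z. F (\<lambda>k. fst z * R * snd z k) i)" if "i \<le> p" for i
  proof (rule continuous_on_compose2 [OF c [OF that]])
    show "continuous_on ({0..1} \<times> unit_sphere p) (\<lambda>z k. fst z * R * snd z k)"
      by (intro continuous_on_coordinatewise_then_product continuous_intros
          continuous_on_product_then_coordinatewise [OF continuous_on_snd [OF continuous_on_id]])
  qed auto
  then have "Brouwer_degree2 p (\<lambda>x. radial p (F (\<lambda>k. 0 * R * x k)))
     = Brouwer_degree2 p (\<lambda>x. radial p (F (\<lambda>k. 1 * R * x k)))"
    using nz by (intro degree_radial_homotopy [where H = "\<lambda>t x. F (\<lambda>k. t * R * x k)"]) auto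
  then show ?thesis by (simp add: Brouwer_degree2_const)
qed

section \<open>The double-angle map on a block of coordinates\<close>

definition double_block :: "nat \<Rightarrow> nat \<Rightarrow> (nat \<Rightarrow> real) \<Rightarrow> nat \<Rightarrow> real" where
  "double_block s l v = (\<lambda>i. if i = s then (v s)\<^sup>2 - (\<Sum>j\<in>{s<..<s+l}. (v j)\<^sup>2)
     else if i \<in> {s<..<s+l} then v s * v i else v i)"

text \<open>Agrees with \<open>double_block\<close> on one half-space and is homotopic to the identity.\<close>
definition half_block :: "nat \<Rightarrow> nat \<Rightarrow> (nat \<Rightarrow> real) \<Rightarrow> nat \<Rightarrow> real" where
  "half_block s l v = (\<lambda>i. if i = s then (max 0 (v s))\<^sup>2 - (min 0 (v s))\<^sup>2 - (\<Sum>j\<in>{s<..<s+l}. (v j)\<^sup>2)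
     else if i \<in> {s<..<s+l} then max 0 (v s) * v i else v i)"

definition negate_block :: "nat \<Rightarrow> nat \<Rightarrow> (nat \<Rightarrow> real) \<Rightarrow> nat \<Rightarrow> real" where
  "negate_block s l v = (\<lambda>i. if i \<in> {s..<s+l} then - v i else v i)"

lemma continuous_on_coordinate: "continuous_on S (\<lambda>v::nat \<Rightarrow> real. v i)"
  by (rule continuous_on_product_then_coordinatewise [OF continuous_on_id])

lemma continuous_on_double_block:
  assumes "\<And>i. continuous_on S (\<lambda>z. f z i)"
  shows "continuous_on S (\<lambda>z. double_block s l (f z) i)"
  unfolding double_block_def
  by (cases "i = s"; cases "i \<in> {s<..<s+l}"; simp del: greaterThanLessThan_iff;
      (intro continuous_intros assms)?)

lemma continuous_on_half_block: "continuous_on S (\<lambda>v. half_block s l v i)"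
  unfolding half_block_def
  by (cases "i = s"; cases "i \<in> {s<..<s+l}"; simp del: greaterThanLessThan_iff;
      (intro continuous_intros continuous_on_coordinate)?)

text \<open>With \<mu> for \<open>v s\<close> and x for the rest of the block, the map squares \<mu>
  + i|x|, keeps the direction of x and drops the factor 2 of the imaginary part. A zero satisfies
  \<mu>^2 = |x|^2 and \<mu> x = 0, which leaves only the origin.\<close>

lemma double_block_nonzero:
  assumes sl: "0 < l" "s + l \<le> Suc p" and v: "\<exists>i\<le>p. v i \<noteq> 0"
  shows "\<exists>i\<le>p. double_block s l v i \<noteq> 0"
proof (rule ccontr)
  assume "\<not> ?thesis"
  then have z: "\<And>i. i \<le> p \<Longrightarrow> double_block s l v i = 0" by blast
  have s: "(v s)\<^sup>2 = (\<Sum>j\<in>{s<..<s+l}. (v j)\<^sup>2)"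
    using z [of s] sl by (simp add: double_block_def)
  have "v s * v j = 0" if "j \<in> {s<..<s+l}" for j
    using z [of j] sl that by (simp add: double_block_def)
  moreover have "v s = 0" if "\<forall>j\<in>{s<..<s+l}. v j = 0"
    using s that by simp
  ultimately have "v s = 0" by (metis mult_eq_0_iff)
  then have "v j = 0" if "j \<in> {s<..<s+l}" for j
    using s that by (simp add: sum_nonneg_eq_0_iff)
  then have "v i = 0" if "i \<le> p" for i
    using \<open>v s = 0\<close> z [OF that] by (auto simp: double_block_def split: if_splits)
  then show False using v by blast
qed

text \<open>If the block is zero apart from \<open>v s\<close>, its component at \<open>s\<close> is
  \<open>v s\<close> times a positive number. If another entry of the block is nonzero, its
  component can vanish only for t = 0 and \<open>v s\<close> \<le> 0, and there the component at
  \<open>s\<close> is negative.\<close>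

lemma half_block_linear_homotopy_nonzero:
  assumes sl: "0 < l" "s + l \<le> Suc p" and v: "\<exists>i\<le>p. v i \<noteq> 0" and t: "0 \<le> t" "t \<le> 1"
  shows "\<exists>i\<le>p. (1 - t) * half_block s l v i + t * v i \<noteq> 0"
proof (rule ccontr)
  assume "\<not> ?thesis"
  then have z: "\<And>i. i \<le> p \<Longrightarrow> (1 - t) * half_block s l v i + t * v i = 0" by blast
  have out: "v i = 0" if "i \<le> p" "i \<notin> {s..<s+l}" for i
    using z [OF that(1)] that(2) sl by (auto simp: half_block_def algebra_simps split: if_splits)
  have zs: "(1 - t) * ((max 0 (v s))\<^sup>2 - (min 0 (v s))\<^sup>2 - (\<Sum>j\<in>{s<..<s+l}. (v j)\<^sup>2)) + t * v s = 0"
    using z [of s] sl by (simp add: half_block_def)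
  show False
  proof (cases "\<forall>j\<in>{s<..<s+l}. v j = 0")
    case True
    have vs: "v s \<noteq> 0"
    proof
      assume "v s = 0"
      then have "v i = 0" if "i \<le> p" for i
        using True out [OF that] by (cases "i = s") auto
      then show False using v by blast
    qed
    have "(1 - t) * ((max 0 (v s))\<^sup>2 - (min 0 (v s))\<^sup>2) + t * v s = 0"
      using zs True by simp
    also have "(max 0 (v s))\<^sup>2 - (min 0 (v s))\<^sup>2 = v s * \<bar>v s\<bar>"
      by (cases "v s \<ge> 0") (auto simp: power2_eq_square)
    finally have "v s * ((1 - t) * \<bar>v s\<bar> + t) = 0" by (simp add: algebra_simps)
    moreover have "(1 - t) * \<bar>v s\<bar> + t > 0"
      using t vs by (cases "t = 0") (auto intro: add_nonneg_pos)
    ultimately show False using vs by simp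
  next
    case False
    then obtain j where j: "j \<in> {s<..<s+l}" "v j \<noteq> 0" by blast
    have "((1 - t) * max 0 (v s) + t) * v j = 0"
      using z [of j] j sl by (simp add: half_block_def algebra_simps)
    then have "(1 - t) * max 0 (v s) + t = 0" using j by simp
    moreover have "(1 - t) * max 0 (v s) \<ge> 0" using t by simp
    ultimately have t0: "t = 0" using t(1) by linarith
    with \<open>(1 - t) * max 0 (v s) + t = 0\<close> have "max 0 (v s) = 0" by simp
    with t0 have "(min 0 (v s))\<^sup>2 + (\<Sum>j\<in>{s<..<s+l}. (v j)\<^sup>2) = 0" using zs by simp
    moreover have "(\<Sum>j\<in>{s<..<s+l}. (v j)\<^sup>2) > 0"
      using j by (intro sum_pos2 [of _ j]) auto
    ultimately show False by (smt (verit) zero_le_power2)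
  qed
qed

text \<open>Multiplication by the imaginary unit, when a block of even length is read as a list of
  complex numbers: consecutive entries (a, b) become (-b, a).\<close>

definition quarter_turn :: "nat \<Rightarrow> nat \<Rightarrow> (nat \<Rightarrow> real) \<Rightarrow> nat \<Rightarrow> real" where
  "quarter_turn s l v = (\<lambda>i. if i \<in> {s..<s+l} then (if even (i - s) then - v (Suc i) else v (i - 1)) else v i)"

lemma quarter_turn_twice:
  assumes "even l"
  shows "quarter_turn s l (quarter_turn s l v) = negate_block s l v"
proof
  fix i
  consider "i \<notin> {s..<s+l}" | "i \<in> {s..<s+l}" "even (i - s)" | "i \<in> {s..<s+l}" "odd (i - s)" by blast
  then show "quarter_turn s l (quarter_turn s l v) i = negate_block s l v i"
  proof cases
    case 2
    have "Suc i \<noteq> s + l" using 2 assms by (metis add_diff_cancel_left' even_Suc Suc_diff_le atLeastLessThan_iff)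
    then have "Suc i \<in> {s..<s+l}" "odd (Suc i - s)" using 2 by (auto simp: Suc_diff_le)
    then show ?thesis using 2 by (simp add: quarter_turn_def negate_block_def)
  next
    case 3
    then have "i \<noteq> s" by auto
    then have "i - 1 \<in> {s..<s+l}" "even (i - 1 - s)" "Suc (i - 1) = i" using 3 by auto
    then show ?thesis using 3 by (simp add: quarter_turn_def negate_block_def)
  qed (auto simp: quarter_turn_def negate_block_def)
qed

lemma quarter_turn_unit_sphere:
  assumes "even l" and sl: "s + l \<le> Suc p" and v: "v \<in> unit_sphere p"
  shows "quarter_turn s l v \<in> unit_sphere p"
proof -
  \<comment> \<open>Up to sign the map permutes the coordinates by the involution
    \<open>\<sigma>\<close> that exchanges the partners of each pair, so the sum of squares is
    unchanged.\<close>
  define \<sigma> where "\<sigma> i = (if i \<in> {s..<s+l} then (if even (i - s) then Suc i else i - 1) else i)" for i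
  have \<sigma>: "\<sigma> (\<sigma> i) = i \<and> (i \<in> {s..<s+l} \<longrightarrow> \<sigma> i \<in> {s..<s+l})" for i
  proof -
    consider "i \<notin> {s..<s+l}" | "i \<in> {s..<s+l}" "even (i - s)" | "i \<in> {s..<s+l}" "odd (i - s)" by blast
    then show ?thesis
    proof cases
      case 2
      have "Suc i \<noteq> s + l" using 2 assms by (metis add_diff_cancel_left' even_Suc Suc_diff_le atLeastLessThan_iff)
      then have "Suc i \<in> {s..<s+l}" "odd (Suc i - s)" using 2 by (auto simp: Suc_diff_le)
      then show ?thesis using 2 by (simp add: \<sigma>_def)
    next
      case 3
      then have "i \<noteq> s" by auto
      then have "i - 1 \<in> {s..<s+l}" "even (i - 1 - s)" "Suc (i - 1) = i" using 3 by auto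
      then show ?thesis using 3 by (simp add: \<sigma>_def)
    qed (auto simp: \<sigma>_def)
  qed
  have "(\<Sum>i\<le>p. (quarter_turn s l v i)\<^sup>2) = (\<Sum>i\<le>p. (v (\<sigma> i))\<^sup>2)"
    by (rule sum.cong) (auto simp: quarter_turn_def \<sigma>_def)
  also have "\<dots> = (\<Sum>i\<le>p. (v i)\<^sup>2)"
  proof (rule sum.reindex_bij_witness [of _ \<sigma> \<sigma>])
    have "\<sigma> i \<le> p" if "i \<le> p" for i
    proof (cases "i \<in> {s..<s+l}")
      case True
      then have "\<sigma> i < s + l" using \<sigma> by auto
      then show ?thesis using sl by linarith
    qed (use that in \<open>auto simp: \<sigma>_def\<close>)
    then show "\<sigma> i \<in> {..p}" if "i \<in> {..p}" for i using that by blast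
    then show "\<sigma> i \<in> {..p}" if "i \<in> {..p}" for i using that by blast
  qed (use \<sigma> in auto)
  finally show ?thesis
    using v sl by (auto simp: unit_sphere_def quarter_turn_def)
qed

text \<open>As the square of the quarter turn, negation has a degree that is a perfect square; as an
  involution, it has degree 1 or -1. Only 1 is left.\<close>

lemma degree_negate_block:
  assumes "even l" "s + l \<le> Suc p"
  shows "continuous_map (nsphere p) (nsphere p) (negate_block s l)" (is ?c)
    and "Brouwer_degree2 p (negate_block s l) = 1"
proof -
  let ?J = "quarter_turn s l"
  have J: "continuous_map (nsphere p) (nsphere p) ?J"
    unfolding continuous_map_nsphere_iff
  proof
    have "continuous_on (unit_sphere p) (\<lambda>v. quarter_turn s l v i)" for i
      unfolding quarter_turn_def
      by (cases "i \<in> {s..<s+l}"; cases "even (i - s)";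
          simp add: continuous_on_minus continuous_on_coordinate del: atLeastLessThan_iff)
    then show "continuous_on (unit_sphere p) (quarter_turn s l)"
      by (rule continuous_on_coordinatewise_then_product)
  qed (simp add: quarter_turn_unit_sphere assms Pi_iff)
  have eq: "negate_block s l = ?J \<circ> ?J"
    by (rule ext) (simp only: o_apply quarter_turn_twice [OF assms(1)])
  then show N: ?c using J continuous_map_compose by metis
  have "negate_block s l \<circ> negate_block s l = id"
    by (auto simp: negate_block_def fun_eq_iff)
  then have "Brouwer_degree2 p (negate_block s l) * Brouwer_degree2 p (negate_block s l) = 1"
    using Brouwer_degree2_compose [OF N N] by simp
  moreover have "Brouwer_degree2 p (negate_block s l) \<ge> 0"
    using Brouwer_degree2_compose [OF J J] eq by simp
  ultimately show "Brouwer_degree2 p (negate_block s l) = 1"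
    by (auto simp: zmult_eq_1_iff)
qed

text \<open>The map doubles the angle to the first axis of the block.  Its restrictions to the two
  half-spaces bounded by the hyperplane orthogonal to that axis contribute equally because
  the block has even length, so that negating it preserves the orientation.\<close>
lemma degree_double_block:
  assumes l: "even l" "0 < l" "s + l \<le> Suc p"
  shows "Brouwer_degree2 p (\<lambda>v. radial p (double_block s l v)) = 2"
proof -
  let ?f = "\<lambda>v. radial p (double_block s l v)"
  let ?g = "\<lambda>v. radial p (half_block s l v)"
  note nz = half_block_linear_homotopy_nonzero [OF l(2,3) unit_sphere_nonzero]
  have g: "continuous_map (nsphere p) (nsphere p) ?g"
    using nz [of _ 0] by (intro continuous_map_radial continuous_on_half_block) auto
  have f: "continuous_map (nsphere p) (nsphere p) ?f"
    using double_block_nonzero [OF l(2,3) unit_sphere_nonzero]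
    by (intro continuous_map_radial continuous_on_double_block continuous_on_coordinate) auto
  note A = degree_negate_block [OF l(1,3)]
  have "Brouwer_degree2 p ?g = Brouwer_degree2 p (\<lambda>v. radial p v)"
    using nz by (intro degree_radial_linear_homotopy continuous_on_half_block continuous_on_coordinate) auto
  also have "\<dots> = Brouwer_degree2 p id"
    by (rule Brouwer_degree2_eq) (simp add: nsphere_eq_top_of_set radial_unit_sphere)
  finally have dg: "Brouwer_degree2 p ?g = 1" by simp
  have "Brouwer_degree2 p ?f = Brouwer_degree2 p (?g \<circ> negate_block s l) + Brouwer_degree2 p ?g"
  proof (rule Brouwer_degree2_hemisphere_additive [OF _ f g continuous_map_compose [OF A(1) g]])
    show "s \<le> p" using l by simp
    show "?f x = ?g x" if "0 \<le> x s" for x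
    proof -
      have "double_block s l x = half_block s l x"
        using that by (auto simp: double_block_def half_block_def max_def min_def)
      then show ?thesis by simp
    qed
    \<comment> \<open>The double-angle map is an even function of the block, so it does not notice
      the negation that carries this half-space to the other one.\<close>
    show "?f x = (?g \<circ> negate_block s l) x" if "x s \<le> 0" for x
    proof -
      have "double_block s l x = half_block s l (negate_block s l x)"
        using that l by (auto simp: double_block_def half_block_def negate_block_def fun_eq_iff intro!: sum.cong)
      then show ?thesis by simp
    qed
    have lower: "?g x s \<le> 0" if "x s \<le> 0" for x
    proof -
      have "half_block s l x s \<le> 0"
      proof -
        have "half_block s l x s = - ((min 0 (x s))\<^sup>2) - (\<Sum>j\<in>{s<..<s+l}. (x j)\<^sup>2)"
          using that by (simp add: half_block_def)
        moreover have "(\<Sum>j\<in>{s<..<s+l}. (x j)\<^sup>2) \<ge> 0" by (intro sum_nonneg) simp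
        moreover have "(min 0 (x s))\<^sup>2 \<ge> 0" by simp
        ultimately show ?thesis by linarith
      qed
      then show ?thesis using \<open>s \<le> p\<close>
        by (simp add: radial_def divide_nonpos_nonneg sum_nonneg)
    qed
    show "?g \<in> {x. x s \<le> 0} \<rightarrow> {x. x s \<le> 0}" using lower by auto
    show "?g \<circ> negate_block s l \<in> {x. 0 \<le> x s} \<rightarrow> {x. x s \<le> 0}"
      using lower l by (auto simp: negate_block_def)
  qed
  also have "\<dots> = 2"
    using Brouwer_degree2_compose [OF A(1) g] A(2) dg by simp
  finally show ?thesis .
qed

section \<open>Doubling several blocks\<close>

definition double_blocks :: "nat \<Rightarrow> nat \<Rightarrow> nat \<Rightarrow> (nat \<Rightarrow> real) \<Rightarrow> nat \<Rightarrow> real" where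
  "double_blocks b l k v = (\<lambda>i. if i div b < k then double_block (i div b * b) l v i else v i)"

lemma block_index_div:
  fixes i j :: nat
  assumes "i \<in> {j * b..<j * b + l}" "l \<le> b"
  shows "i div b = j"
  using assms by (intro div_nat_eqI) (auto simp: algebra_simps)

text \<open>Distinct blocks do not interact: the first \<open>k\<close> doublings leave the entries
  of block \<open>k\<close> alone, and doubling block \<open>k\<close> changes no other entry. This
  turns the product map into a composition.\<close>

lemma double_blocks_Suc:
  assumes "0 < l" "l \<le> b"
  shows "double_blocks b l (Suc k) v = double_block (k * b) l (double_blocks b l k v)"
proof
  fix i
  have eq: "double_blocks b l k v j = v j" if "j \<in> {k * b..<k * b + l}" for j
    using block_index_div [OF that assms(2)] by (simp add: double_blocks_def)
  show "double_blocks b l (Suc k) v i = double_block (k * b) l (double_blocks b l k v) i"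
  proof (cases "i \<in> {k * b..<k * b + l}")
    case True
    then have d: "i div b = k" using block_index_div assms by blast
    have "double_block (k * b) l (double_blocks b l k v) i = double_block (k * b) l v i"
      using True eq by (auto simp: double_block_def intro!: sum.cong)
    then show ?thesis using d by (simp add: double_blocks_def)
  next
    case False
    then have "i \<noteq> k * b" "i \<notin> {k * b<..<k * b + l}" using assms by auto
    then show ?thesis by (auto simp: double_blocks_def double_block_def less_Suc_eq)
  qed
qed

lemma continuous_on_double_blocks: "continuous_on S (\<lambda>v. double_blocks b l k v i)"
  unfolding double_blocks_def
  by (cases "i div b < k") (auto intro!: continuous_on_double_block continuous_on_coordinate)

lemma degree_double_blocks:
  assumes l: "even l" "0 < l" "l \<le> b" and "k * b \<le> Suc p"
  shows "(\<forall>v. (\<exists>i\<le>p. v i \<noteq> 0) \<longrightarrow> (\<exists>i\<le>p. double_blocks b l k v i \<noteq> 0)) \<and>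
    Brouwer_degree2 p (\<lambda>v. radial p (double_blocks b l k v)) = 2 ^ k"
  using assms(4)
proof (induction k)
  case 0
  have "Brouwer_degree2 p (\<lambda>v. radial p v) = Brouwer_degree2 p id"
    by (rule Brouwer_degree2_eq) (simp add: nsphere_eq_top_of_set radial_unit_sphere)
  then show ?case by (simp add: double_blocks_def)
next
  case (Suc k)
  let ?Q = "double_blocks b l k" and ?D = "double_block (k * b) l"
  have kl: "k * b + l \<le> Suc p" using Suc.prems l by simp
  have nzQ: "\<exists>i\<le>p. ?Q v i \<noteq> 0" if "\<exists>i\<le>p. v i \<noteq> 0" for v
    using Suc that by auto
  have nzD: "\<exists>i\<le>p. ?D v i \<noteq> 0" if "\<exists>i\<le>p. v i \<noteq> 0" for v
    using double_block_nonzero [OF l(2) kl that] .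
  have Qc: "continuous_map (nsphere p) (nsphere p) (\<lambda>v. radial p (?Q v))"
    using nzQ unit_sphere_nonzero by (intro continuous_map_radial continuous_on_double_blocks) auto
  have Dc: "continuous_map (nsphere p) (nsphere p) (\<lambda>v. radial p (?D v))"
    using nzD unit_sphere_nonzero
    by (intro continuous_map_radial continuous_on_double_block continuous_on_coordinate) auto
  \<comment> \<open>Multiplicativity of the degree needs maps of the sphere, so the inner map is
    normalised first. Every component of \<open>?D\<close> is homogeneous, of degree 2 in the
    doubled part and 1 elsewhere, so this changes the components by positive factors only.\<close>
  have "Brouwer_degree2 p (\<lambda>v. radial p (?D (?Q v))) = Brouwer_degree2 p (\<lambda>v. radial p (?D (radial p (?Q v))))"
  proof (rule degree_radial_same_sign)
    show "continuous_on (unit_sphere p) (\<lambda>x. ?D (?Q x) i)" for i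
      by (intro continuous_on_double_block continuous_on_double_blocks)
    show "continuous_on (unit_sphere p) (\<lambda>x. ?D (radial p (?Q x)) i)" for i
      using Qc continuous_on_double_block continuous_on_product_then_coordinatewise
      unfolding continuous_map_nsphere_iff by metis
    show "\<exists>i\<le>p. ?D (?Q x) i \<noteq> 0" if "x \<in> unit_sphere p" for x
      using nzD nzQ unit_sphere_nonzero that by blast
  next
    fix x i assume x: "x \<in> unit_sphere p" and i: "i \<le> p"
    let ?v = "?Q x" and ?r = "sqrt (\<Sum>i\<le>p. (?Q x i)\<^sup>2)"
    have r: "?r > 0" using nzQ [OF unit_sphere_nonzero [OF x]] sum_squares_pos by fastforce
    have rad: "radial p ?v j = ?v j / ?r" if "j \<le> p" for j using that by (simp add: radial_def)
    have "sgn (a / c) = sgn a" if "c > 0" for a c :: real using that by (simp add: sgn_divide)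
    note sg = this [OF r] this [OF zero_less_power [OF r]]
    consider "i = k * b" | "i \<in> {k * b<..<k * b + l}" | "i \<noteq> k * b" "i \<notin> {k * b<..<k * b + l}" by blast
    then show "sgn (?D ?v i) = sgn (?D (radial p ?v) i)"
    proof cases
      case 1
      have "?D (radial p ?v) i = (?v i / ?r)\<^sup>2 - (\<Sum>j\<in>{k * b<..<k * b + l}. (?v j / ?r)\<^sup>2)"
      proof -
        have "(\<Sum>j\<in>{k * b<..<k * b + l}. (radial p ?v j)\<^sup>2) = (\<Sum>j\<in>{k * b<..<k * b + l}. (?v j / ?r)\<^sup>2)"
          by (rule sum.cong) (use rad kl in auto)
        then show ?thesis using 1 i rad by (simp add: double_block_def)
      qed
      also have "\<dots> = ?D ?v i / ?r\<^sup>2"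
        using 1 by (simp add: double_block_def power_divide diff_divide_distrib flip: sum_divide_distrib)
      finally show ?thesis by (simp only: sg)
    next
      case 2
      then have "?D (radial p ?v) i = ?D ?v i / ?r\<^sup>2"
        using i kl rad by (simp add: double_block_def power2_eq_square)
      then show ?thesis by (simp only: sg)
    next
      case 3
      then have "?D (radial p ?v) i = ?D ?v i / ?r"
        using i by (simp add: double_block_def rad del: greaterThanLessThan_iff)
      then show ?thesis by (simp only: sg)
    qed
  qed
  also have "\<dots> = Brouwer_degree2 p ((\<lambda>v. radial p (?D v)) \<circ> (\<lambda>v. radial p (?Q v)))"
    by (simp add: o_def)
  also have "\<dots> = 2 * 2 ^ k"
    using Brouwer_degree2_compose [OF Qc Dc] degree_double_block [OF l(1,2) kl] Suc by simp
  finally show ?case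
    using nzD nzQ by (simp add: double_blocks_Suc [OF l(2,3)])
qed

section \<open>Antipodal coincidences\<close>

lemma sum_lessThan_add:
  fixes g :: "nat \<Rightarrow> 'a::comm_monoid_add"
  shows "(\<Sum>r<a + b. g r) = (\<Sum>r<a. g r) + (\<Sum>r<b. g (a + r))"
  by (induction b) (simp_all add: add.assoc)

text \<open>Coordinates come in \<open>N\<close> blocks \<open>(\<mu>, x, y, \<lambda>)\<close> of length \<open>1 + m + m + 1\<close>.\<close>
definition assemble :: "nat \<Rightarrow> (nat \<Rightarrow> real) \<Rightarrow> (nat \<Rightarrow> nat \<Rightarrow> real) \<Rightarrow> (nat \<Rightarrow> nat \<Rightarrow> real) \<Rightarrow> (nat \<Rightarrow> real)
    \<Rightarrow> nat \<Rightarrow> real" where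
  "assemble m a e f d i =
    (let j = i div (2 * m + 2); r = i mod (2 * m + 2)
     in if r = 0 then a j else if r \<le> m then e j (r - 1) else if r \<le> 2 * m then f j (r - 1 - m) else d j)"

context
  fixes m :: nat
begin

abbreviation slot_mu :: "nat \<Rightarrow> nat" where "slot_mu j \<equiv> j * (2 * m + 2)"
abbreviation slot_x :: "nat \<Rightarrow> nat \<Rightarrow> nat" where "slot_x j c \<equiv> j * (2 * m + 2) + (1 + c)"
abbreviation slot_y :: "nat \<Rightarrow> nat \<Rightarrow> nat" where "slot_y j c \<equiv> j * (2 * m + 2) + (1 + m + c)"
abbreviation slot_la :: "nat \<Rightarrow> nat" where "slot_la j \<equiv> j * (2 * m + 2) + (2 * m + 1)"

lemma assemble_at:
  "r < 2 * m + 2 \<Longrightarrow> assemble m a e f d (j * (2 * m + 2) + r) =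
     (if r = 0 then a j else if r \<le> m then e j (r - 1) else if r \<le> 2 * m then f j (r - 1 - m) else d j)"
proof -
  assume r: "r < 2 * m + 2"
  have "(j * (2 * m + 2) + r) div (2 * m + 2) = j"
    using r by (intro div_nat_eqI) (auto simp: algebra_simps)
  moreover have "(j * (2 * m + 2) + r) mod (2 * m + 2) = r"
    using r by (simp only: mod_mult_self3 mod_less)
  ultimately show ?thesis unfolding assemble_def Let_def by (simp only:)
qed

lemma assemble_slots:
  "assemble m a e f d (slot_mu j) = a j"
  "c < m \<Longrightarrow> assemble m a e f d (slot_x j c) = e j c"
  "c < m \<Longrightarrow> assemble m a e f d (slot_y j c) = f j c"
  "assemble m a e f d (slot_la j) = d j"
  using assemble_at [of 0 a e f d j] assemble_at [of "1 + c" a e f d j]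
    assemble_at [of "1 + m + c" a e f d j] assemble_at [of "2 * m + 1" a e f d j]
  by auto

lemma slot_bound: "j < N \<Longrightarrow> r < 2 * m + 2 \<Longrightarrow> j * (2 * m + 2) + r < N * (2 * m + 2)"
  using mult_le_mono1 [of "Suc j" N "2 * m + 2"] by simp

lemma assemble_zeroD:
  assumes "\<And>i. i < N * (2 * m + 2) \<Longrightarrow> assemble m a e f d i = 0" and j: "j < N"
  shows "a j = 0" "c < m \<Longrightarrow> e j c = 0" "c < m \<Longrightarrow> f j c = 0" "d j = 0"
proof -
  note z = assms(1) [OF slot_bound [OF j]]
  show "a j = 0" using z [of 0] assemble_slots(1) [of a e f d j] by simp
  show "e j c = 0" if "c < m" using z [of "1 + c"] assemble_slots(2) [OF that, of a e f d j] that by simp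
  show "f j c = 0" if "c < m" using z [of "1 + m + c"] assemble_slots(3) [OF that, of a e f d j] that by simp
  show "d j = 0" using z [of "2 * m + 1"] assemble_slots(4) [of a e f d j] by simp
qed

text \<open>Allows a straight-line homotopy between two assembled maps to be analysed one block at a
  time.\<close>

lemma assemble_linear:
  "(1 - t) * assemble m a e f d i + t * assemble m a' e' f' d' i =
   assemble m (\<lambda>j. (1 - t) * a j + t * a' j) (\<lambda>j c. (1 - t) * e j c + t * e' j c)
     (\<lambda>j c. (1 - t) * f j c + t * f' j c) (\<lambda>j. (1 - t) * d j + t * d' j) i"
  by (simp add: assemble_def Let_def)

lemma continuous_on_assemble:
  assumes "\<And>j. j < N \<Longrightarrow> continuous_on S (\<lambda>z. a z j)"
    and "\<And>j c. j < N \<Longrightarrow> c < m \<Longrightarrow> continuous_on S (\<lambda>z. e z j c)"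
    and "\<And>j c. j < N \<Longrightarrow> c < m \<Longrightarrow> continuous_on S (\<lambda>z. f z j c)"
    and "\<And>j. j < N \<Longrightarrow> continuous_on S (\<lambda>z. d z j)"
    and i: "i < N * (2 * m + 2)"
  shows "continuous_on S (\<lambda>z. assemble m (a z) (e z) (f z) (d z) i)"
proof -
  have j: "i div (2 * m + 2) < N" using i by (simp add: less_mult_imp_div_less)
  let ?r = "i mod (2 * m + 2)"
  consider "?r = 0" | "?r \<noteq> 0" "?r \<le> m" | "?r \<noteq> 0" "\<not> ?r \<le> m" "?r \<le> 2 * m" | "?r \<noteq> 0" "\<not> ?r \<le> m" "\<not> ?r \<le> 2 * m"
    by blast
  then show ?thesis
    unfolding assemble_def Let_def
  proof cases
    case 2
    then have "?r - 1 < m" by simp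
    then have "continuous_on S (\<lambda>z. e z (i div (2 * m + 2)) (?r - 1))" using assms(2) j by blast
    then show "continuous_on S (\<lambda>z. if ?r = 0 then a z (i div (2 * m + 2))
       else if ?r \<le> m then e z (i div (2 * m + 2)) (?r - 1)
       else if ?r \<le> 2 * m then f z (i div (2 * m + 2)) (?r - 1 - m) else d z (i div (2 * m + 2)))"
      using 2 by (simp only: if_True if_False)
  next
    case 3
    then have "?r - 1 - m < m" by simp
    then have "continuous_on S (\<lambda>z. f z (i div (2 * m + 2)) (?r - 1 - m))" using assms(3) j by blast
    then show "continuous_on S (\<lambda>z. if ?r = 0 then a z (i div (2 * m + 2))
       else if ?r \<le> m then e z (i div (2 * m + 2)) (?r - 1)
       else if ?r \<le> 2 * m then f z (i div (2 * m + 2)) (?r - 1 - m) else d z (i div (2 * m + 2)))"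
      using 3 by (simp only: if_True if_False)
  qed (simp_all only: simp_thms if_True if_False assms j)
qed

lemma sum_blocks:
  "(\<Sum>i<N * (2 * m + 2). (g i :: real)) =
   (\<Sum>j<N. g (slot_mu j) + (\<Sum>c<m. g (slot_x j c)) + (\<Sum>c<m. g (slot_y j c)) + g (slot_la j))"
proof -
  have "(\<Sum>i = s..<s + (2 * m + 2). g i) = g s + (\<Sum>c<m. g (s + (1 + c))) + (\<Sum>c<m. g (s + (1 + m + c))) + g (s + (2 * m + 1))" for s
  proof -
    have "(\<Sum>i = s..<s + (2 * m + 2). g i) = (\<Sum>r<2 * m + 2. g (s + r))"
      using sum.shift_bounds_nat_ivl [of g 0 s "2 * m + 2"] by (simp add: add.commute lessThan_atLeast0)
    also have "\<dots> = (\<Sum>r<1 + m + m + 1. g (s + r))" by (simp add: mult_2)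
    also have "\<dots> = g s + (\<Sum>c<m. g (s + (1 + c))) + (\<Sum>c<m. g (s + (1 + m + c))) + g (s + (1 + m + m))"
      by (simp only: sum_lessThan_add) simp
    finally show ?thesis by (simp add: mult_2)
  qed
  then show ?thesis
    using sum.nat_group [of g "2 * m + 2" N] by (simp only:)
qed

end

section \<open>Zeros of the homotopies within one block\<close>

definition ramp :: "real \<Rightarrow> real" where "ramp t = max 0 (1 + t)"

text \<open>The first two equations give |x| = |y| = 1, the others A = -(\<open>ramp la\<close>) y
  and B = -(\<open>ramp mu\<close>) y with unit vectors A and B. So both factors have absolute value
  1; being nonnegative they equal 1, and \<open>ramp\<close> takes the value 1 only at 0.\<close>

lemma coincidence_block:
  fixes x y A B :: "nat \<Rightarrow> real"
  assumes X: "1 - (\<Sum>c<m. (x c)\<^sup>2) = 0" and XY: "(\<Sum>c<m. (x c)\<^sup>2) - (\<Sum>c<m. (y c)\<^sup>2) = 0"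
    and A: "\<And>c. c < m \<Longrightarrow> A c + ramp la * y c = 0"
    and AB: "\<And>c. c < m \<Longrightarrow> A c - B c + (ramp la - ramp mu) * y c = 0"
    and nA: "(\<Sum>c<m. (A c)\<^sup>2) = (\<Sum>c<m. (x c)\<^sup>2)" and nB: "(\<Sum>c<m. (B c)\<^sup>2) = (\<Sum>c<m. (x c)\<^sup>2)"
  shows "la = 0 \<and> mu = 0 \<and> (\<forall>c<m. A c = - y c \<and> B c = - y c)"
proof -
  have B: "B c = - (ramp mu * y c)" if "c < m" for c using A [OF that] AB [OF that] by (simp add: algebra_simps)
  have Ac: "A c = - (ramp la * y c)" if "c < m" for c using A [OF that] by linarith
  have one: "s = 0" if "(\<Sum>c<m. (D c)\<^sup>2) = 1" "\<And>c. c < m \<Longrightarrow> D c = - (ramp s * y c)" for D s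
  proof -
    have "1 = (\<Sum>c<m. (ramp s)\<^sup>2 * (y c)\<^sup>2)" using that by (simp add: power_mult_distrib)
    also have "\<dots> = (ramp s)\<^sup>2" using X XY by (simp flip: sum_distrib_left)
    finally have "ramp s = 1 \<or> ramp s = - 1" by (simp add: power2_eq_1_iff)
    moreover have "ramp s \<ge> 0" by (simp add: ramp_def)
    ultimately have "ramp s = 1" by auto
    then show ?thesis by (simp add: ramp_def max_def split: if_splits)
  qed
  have "la = 0" "mu = 0" using one [of A la] one [of B mu] Ac B nA nB X by auto
  then show ?thesis using Ac B by (simp add: ramp_def)
qed

text \<open>In fact \<open>la\<close> = \<open>mu\<close> = 0 and |x|^2 = |y|^2 = 1 - t at such a
  zero. The bound 2 per block confines the zeros of the homotopy to a fixed ball.\<close>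

lemma linear_homotopy_block:
  fixes x y :: "nat \<Rightarrow> real" and m :: nat
  defines "X \<equiv> \<Sum>c<m. (x c)\<^sup>2" and "Y \<equiv> \<Sum>c<m. (y c)\<^sup>2"
  assumes t: "0 \<le> t" "t \<le> 1"
    and 1: "(1 - t) * (1 - X) + t * (mu\<^sup>2 - X) = 0"
    and 2: "\<And>c. c < m \<Longrightarrow> (1 - t) * (x c - x c + (ramp la - ramp mu) * y c) + t * (mu * x c) = 0"
    and 3: "\<And>c. c < m \<Longrightarrow> (1 - t) * (x c + ramp la * y c) + t * (x c + y c) = 0"
    and 4: "(1 - t) * (X - Y) + t * la = 0"
  shows "mu\<^sup>2 + X + Y + la\<^sup>2 \<le> 2"
proof -
  \<comment> \<open>The third equation reads x = -k y. As k - 1 vanishes or has the sign of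
    \<open>la\<close>, the two terms of the fourth equation cannot have opposite signs.\<close>
  define k where "k = (1 - t) * ramp la + t"
  have x: "x c = - (k * y c)" if "c < m" for c
    using 3 [OF that] by (simp add: k_def algebra_simps)
  have X: "X = k\<^sup>2 * Y"
    unfolding X_def Y_def sum_distrib_left by (rule sum.cong) (auto simp: x power_mult_distrib)
  have Y0: "Y \<ge> 0" unfolding Y_def by (simp add: sum_nonneg)
  have X1: "X = (1 - t) + t * mu\<^sup>2" using 1 by (simp add: algebra_simps)
  have r0: "ramp la \<ge> 0" by (simp add: ramp_def)
  have k0: "k \<ge> 0" using r0 t by (simp add: k_def)
  have eq: "(1 - t) * ((k\<^sup>2 - 1) * Y) + t * la = 0" using 4 X by (simp add: algebra_simps)
  have la: "la = 0"
  proof (rule ccontr)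
    assume "la \<noteq> 0"
    have kt: "k - 1 = (1 - t) * (ramp la - 1)" by (simp add: k_def algebra_simps)
    have "t * la = 0 \<and> (1 - t) * ((k\<^sup>2 - 1) * Y) = 0"
    proof (cases "la > 0")
      case True
      then have "k \<ge> 1" using kt t by (simp add: ramp_def) (smt (verit) mult_nonneg_nonneg)
      then have "k\<^sup>2 - 1 \<ge> 0" by simp
      then have "(1 - t) * ((k\<^sup>2 - 1) * Y) \<ge> 0" using t Y0 by simp
      moreover have "t * la \<ge> 0" using t True by simp
      ultimately show ?thesis using eq by linarith
    next
      case False
      then have "ramp la \<le> 1" by (simp add: ramp_def)
      then have "k \<le> 1" using kt t by (smt (verit) mult_nonneg_nonpos)
      then have "k\<^sup>2 - 1 \<le> 0" using k0 by (simp add: power_le_one)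
      then have "(1 - t) * ((k\<^sup>2 - 1) * Y) \<le> 0" using t Y0 by (simp add: mult_nonneg_nonpos mult_nonpos_nonneg)
      moreover have "t * la \<le> 0" using t False by (simp add: mult_nonneg_nonpos)
      ultimately show ?thesis using eq by linarith
    qed
    \<comment> \<open>At t = 0 the factor \<open>k\<close> is \<open>ramp la\<close>, which differs
      from 1, so y and then x would vanish; but the first equation demands |x| = 1.\<close>
    then have t0: "t = 0" and kY: "(k\<^sup>2 - 1) * Y = 0" using \<open>la \<noteq> 0\<close> by auto
    have "k = ramp la" using t0 by (simp add: k_def)
    then have "k \<noteq> 1" using \<open>la \<noteq> 0\<close> by (auto simp: ramp_def max_def)
    then have "k\<^sup>2 - 1 \<noteq> 0" using k0 by (simp add: power2_eq_1_iff)
    then have "Y = 0" using kY by simp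
    then have "X = 0" using X by simp
    then show False using X1 t0 by simp
  qed
  then have k1: "k = 1" by (simp add: k_def ramp_def)
  have mu: "mu = 0"
  proof (rule ccontr)
    assume mu: "mu \<noteq> 0"
    \<comment> \<open>With y = -x and \<open>ramp la\<close> = 1 the second equation becomes w x =
      0. Since \<open>w\<close> has the sign of \<open>mu\<close>, x would vanish, against the first
      equation.\<close>
    define w where "w = (1 - t) * (ramp mu - 1) + t * mu"
    have w: "w \<noteq> 0"
    proof (cases "mu > 0")
      case True
      then have "w = mu" by (simp add: w_def ramp_def algebra_simps)
      then show ?thesis using mu by simp
    next
      case False
      then have "ramp mu - 1 < 0" using mu by (simp add: ramp_def)
      then have "(1 - t) * (ramp mu - 1) \<le> 0" using t by (simp add: mult_nonneg_nonpos)
      moreover have "t * mu \<le> 0" using t False by (simp add: mult_nonneg_nonpos)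
      moreover have "t = 0 \<Longrightarrow> w < 0" using \<open>ramp mu - 1 < 0\<close> by (simp add: w_def)
      moreover have "t \<noteq> 0 \<Longrightarrow> t * mu < 0" using t False mu by (simp add: mult_pos_neg)
      ultimately show ?thesis unfolding w_def by linarith
    qed
    have "w * x c = 0" if "c < m" for c
      using 2 [OF that] x [OF that] k1 la by (simp add: w_def ramp_def algebra_simps)
    then have "x c = 0" if "c < m" for c using w that by simp
    then have "X = 0" by (simp add: X_def)
    moreover have "t * mu\<^sup>2 \<ge> 0" using t by simp
    ultimately have "1 - t = 0" "t * mu\<^sup>2 = 0" using X1 t by linarith+
    then show False using mu by simp
  qed
  show ?thesis using X X1 k1 la mu t by simp
qed

text \<open>The homotopy only undoes the shear that sends y to x + y. The first two equations force
  \<open>mu\<close> = 0 and x = 0 at every time, after which the third gives y = 0.\<close>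

lemma shear_homotopy_block:
  fixes x y :: "nat \<Rightarrow> real"
  assumes 1: "(1 - t) * (mu\<^sup>2 - (\<Sum>c<m. (x c)\<^sup>2)) + t * (mu\<^sup>2 - (\<Sum>c<m. (x c)\<^sup>2)) = 0"
    and 2: "\<And>c. c < m \<Longrightarrow> (1 - t) * (mu * x c) + t * (mu * x c) = 0"
    and 3: "\<And>c. c < m \<Longrightarrow> (1 - t) * (x c + y c) + t * y c = 0"
    and 4: "(1 - t) * la + t * la = 0"
  shows "mu\<^sup>2 + (\<Sum>c<m. (x c)\<^sup>2) + (\<Sum>c<m. (y c)\<^sup>2) + la\<^sup>2 = 0"
proof -
  have m2: "mu\<^sup>2 = (\<Sum>c<m. (x c)\<^sup>2)" and la: "la = 0" using 1 4 by (simp_all add: algebra_simps)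
  have "mu * x c = 0" if "c < m" for c using 2 [OF that] by (simp add: algebra_simps)
  then have "mu = 0" using m2 by (cases "mu = 0") auto
  moreover from this have "x c = 0" if "c < m" for c using m2 that by (simp add: sum_nonneg_eq_0_iff)
  moreover from this have "y c = 0" if "c < m" for c using 3 [OF that] that by (simp add: algebra_simps)
  ultimately show ?thesis using la by simp
qed

text \<open>Matches the two descriptions of a block: the \<open>m + 1\<close> entries (\<mu>, x) are
  doubled, the other \<open>m + 1\<close> entries (y, \<lambda>) of the period
  \<open>2 * m + 2\<close> are kept.\<close>

lemma double_blocks_eq_assemble:
  assumes i: "i < N * (2 * m + 2)"
  shows "double_blocks (2 * m + 2) (m + 1) N v i =
    assemble m (\<lambda>j. (v (slot_mu m j))\<^sup>2 - (\<Sum>c<m. (v (slot_x m j c))\<^sup>2)) (\<lambda>j c. v (slot_mu m j) * v (slot_x m j c))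
      (\<lambda>j c. v (slot_y m j c)) (\<lambda>j. v (slot_la m j)) i"
proof -
  define j r where "j = i div (2 * m + 2)" and "r = i mod (2 * m + 2)"
  have ij: "i = j * (2 * m + 2) + r" unfolding j_def r_def by (simp only: div_mult_mod_eq)
  have r: "r < 2 * m + 2" unfolding r_def by simp
  have j: "j < N" using i by (simp add: j_def less_mult_imp_div_less)
  have sum: "(\<Sum>i\<in>{s<..<s + (m + 1)}. (v i)\<^sup>2) = (\<Sum>c<m. (v (s + (1 + c)))\<^sup>2)" for s
    by (rule sum.reindex_bij_witness [of _ "\<lambda>c. s + (1 + c)" "\<lambda>i. i - (s + 1)"]) auto
  have "double_blocks (2 * m + 2) (m + 1) N v i = double_block (j * (2 * m + 2)) (m + 1) v i"
    using j by (simp only: double_blocks_def j_def [symmetric] if_True)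
  also have "\<dots> = (if r = 0 then (v (slot_mu m j))\<^sup>2 - (\<Sum>c<m. (v (slot_x m j c))\<^sup>2)
     else if r \<le> m then v (slot_mu m j) * v i else v i)"
    unfolding double_block_def sum using ij by auto
  finally have eq: "double_blocks (2 * m + 2) (m + 1) N v i = \<dots>" .
  show ?thesis
  proof (cases "r \<le> 2 * m")
    case False
    then have "r = 2 * m + 1" using r by linarith
    show ?thesis unfolding eq unfolding ij \<open>r = 2 * m + 1\<close> assemble_slots(4) by simp
  next
    case True
    then show ?thesis unfolding eq unfolding ij assemble_at [OF r] by auto
  qed
qed

text \<open>On a sphere that encloses all relevant zeros, \<open>\<Phi> 1\<close> is deformed
  without zeros through \<open>\<Phi> 0\<close> and \<open>G\<close> to the product \<open>Q\<close>
  of double-angle maps, whose degree \<open>2 ^ N\<close> is not 0. So \<open>\<Phi> 1\<close>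
  vanishes somewhere inside, and its zeros are the points sought.\<close>

theorem antipodal_coincidence:
  fixes A B :: "real \<Rightarrow> (nat \<Rightarrow> real) \<Rightarrow> nat \<Rightarrow> nat \<Rightarrow> real"
  assumes N: "N > 0" and m: "odd m"
    and cA: "\<And>j c. \<lbrakk>j < N; c < m\<rbrakk> \<Longrightarrow> continuous_on ({0..1} \<times> UNIV) (\<lambda>z. A (fst z) (snd z) j c)"
    and cB: "\<And>j c. \<lbrakk>j < N; c < m\<rbrakk> \<Longrightarrow> continuous_on ({0..1} \<times> UNIV) (\<lambda>z. B (fst z) (snd z) j c)"
    and nA: "\<And>t v j. \<lbrakk>0 \<le> t; t \<le> 1; j < N\<rbrakk> \<Longrightarrow> (\<Sum>c<m. (A t v j c)\<^sup>2) = (\<Sum>c<m. (v (slot_x m j c))\<^sup>2)"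
    and nB: "\<And>t v j. \<lbrakk>0 \<le> t; t \<le> 1; j < N\<rbrakk> \<Longrightarrow> (\<Sum>c<m. (B t v j c)\<^sup>2) = (\<Sum>c<m. (v (slot_x m j c))\<^sup>2)"
    and A0: "\<And>v j c. \<lbrakk>j < N; c < m\<rbrakk> \<Longrightarrow> A 0 v j c = v (slot_x m j c)"
    and B0: "\<And>v j c. \<lbrakk>j < N; c < m\<rbrakk> \<Longrightarrow> B 0 v j c = v (slot_x m j c)"
  obtains v where "\<And>i. i \<ge> N * (2 * m + 2) \<Longrightarrow> v i = 0"
    and "\<And>j. j < N \<Longrightarrow> (\<Sum>c<m. (v (slot_x m j c))\<^sup>2) = 1 \<and> (\<Sum>c<m. (v (slot_y m j c))\<^sup>2) = 1 \<and>
        v (slot_mu m j) = 0 \<and> v (slot_la m j) = 0"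
    and "\<And>j c. \<lbrakk>j < N; c < m\<rbrakk> \<Longrightarrow> A 1 v j c = - v (slot_y m j c) \<and> B 1 v j c = - v (slot_y m j c)"
proof -
  define p where "p = N * (2 * m + 2) - 1"
  have p: "Suc p = N * (2 * m + 2)" using N by (simp add: p_def)
  have ip: "i \<le> p \<longleftrightarrow> i < N * (2 * m + 2)" for i using p by auto
  \<comment> \<open>Over the \<open>N\<close> blocks, zeros of the maps in the homotopies have sum
    of squares at most \<open>2 * N\<close>, so none lies on the sphere of squared radius
    \<open>2 * N + 1\<close>.\<close>
  define R where "R = sqrt (2 * real N + 1)"
  have R2: "R\<^sup>2 = 2 * real N + 1" by (simp add: R_def)
  \<comment> \<open>Vanishes exactly where \<open>|x| = |y| = 1\<close>, both auxiliary scalars are 0 and \<open>A = B = - y\<close>: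
    the factors \<open>ramp\<close> are nonnegative, which excludes the solutions \<open>A = y\<close>, and equal 1 only at 0.\<close>
  define \<Phi> where "\<Phi> t v = assemble m
      (\<lambda>j. 1 - (\<Sum>c<m. (v (slot_x m j c))\<^sup>2))
      (\<lambda>j c. A t v j c - B t v j c + (ramp (v (slot_la m j)) - ramp (v (slot_mu m j))) * v (slot_y m j c))
      (\<lambda>j c. A t v j c + ramp (v (slot_la m j)) * v (slot_y m j c))
      (\<lambda>j. (\<Sum>c<m. (v (slot_x m j c))\<^sup>2) - (\<Sum>c<m. (v (slot_y m j c))\<^sup>2))" for t v
  define G where "G v = assemble m
      (\<lambda>j. (v (slot_mu m j))\<^sup>2 - (\<Sum>c<m. (v (slot_x m j c))\<^sup>2))
      (\<lambda>j c. v (slot_mu m j) * v (slot_x m j c))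
      (\<lambda>j c. v (slot_x m j c) + v (slot_y m j c))
      (\<lambda>j. v (slot_la m j))" for v
  define Q where "Q = double_blocks (2 * m + 2) (m + 1) N"
  have total: "(\<Sum>j<N. (v (slot_mu m j))\<^sup>2 + (\<Sum>c<m. (v (slot_x m j c))\<^sup>2) + (\<Sum>c<m. (v (slot_y m j c))\<^sup>2)
      + (v (slot_la m j))\<^sup>2) = (\<Sum>i\<le>p. (v i)\<^sup>2)" for v :: "nat \<Rightarrow> real"
    using sum_blocks [where g = "\<lambda>i. (v i)\<^sup>2" and m = m and N = N] p by (simp only: lessThan_Suc_atMost [symmetric])
  have RS: "(\<Sum>i\<le>p. (R * x i)\<^sup>2) = 2 * real N + 1" if "x \<in> unit_sphere p" for x
    using that by (simp add: unit_sphere_def power_mult_distrib R2 flip: sum_distrib_left)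
  have cR: "continuous_on S (\<lambda>x::nat\<Rightarrow>real. (\<lambda>k. R * x k))" for S
    by (intro continuous_on_coordinatewise_then_product continuous_intros continuous_on_coordinate)
  have cc: "continuous_on S (\<lambda>z. snd z k)" for S :: "(real \<times> (nat \<Rightarrow> real)) set" and k
    by (rule continuous_on_product_then_coordinatewise [OF continuous_on_snd [OF continuous_on_id]])
  have cr: "continuous_on S (\<lambda>z. ramp (f z))" if "continuous_on S f" for S :: "'z::topological_space set" and f
    unfolding ramp_def by (intro continuous_intros that)
  have \<Phi>c: "continuous_on ({0..1} \<times> UNIV) (\<lambda>z. \<Phi> (fst z) (snd z) i)" if "i \<le> p" for i
    unfolding \<Phi>_def using that ip
    by (intro continuous_on_assemble [where N = N] continuous_intros cA cB cr cc) auto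
  have Gc: "continuous_on S (\<lambda>v. G v i)" if "i \<le> p" for i S
    unfolding G_def using that ip
    by (intro continuous_on_assemble [where N = N] continuous_intros continuous_on_coordinate) auto
  have Qc: "continuous_on S (\<lambda>v. Q v i)" for i S
    unfolding Q_def by (rule continuous_on_double_blocks)
  have zero: "(\<Sum>c<m. (v (slot_x m j c))\<^sup>2) = 1 \<and> (\<Sum>c<m. (v (slot_y m j c))\<^sup>2) = 1 \<and>
      v (slot_la m j) = 0 \<and> v (slot_mu m j) = 0 \<and>
      (\<forall>c<m. A t v j c = - v (slot_y m j c) \<and> B t v j c = - v (slot_y m j c))"
    if t: "0 \<le> t" "t \<le> 1" and z: "\<And>i. i \<le> p \<Longrightarrow> \<Phi> t v i = 0" and j: "j < N" for t v j
  proof -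
    note D = assemble_zeroD [OF z [unfolded \<Phi>_def ip] j]
    have "v (slot_la m j) = 0 \<and> v (slot_mu m j) = 0 \<and>
      (\<forall>c<m. A t v j c = - v (slot_y m j c) \<and> B t v j c = - v (slot_y m j c))"
      using D(3) D(2) nA [OF t j] nB [OF t j] by (intro coincidence_block [OF D(1) D(4)])
    then show ?thesis using D(1,4) by auto
  qed
  have \<Phi>R: "\<exists>i\<le>p. \<Phi> t (\<lambda>k. R * x k) i \<noteq> 0" if t: "0 \<le> t" "t \<le> 1" and x: "x \<in> unit_sphere p" for t x
  proof (rule ccontr)
    assume "\<not> ?thesis"
    then have z: "\<And>i. i \<le> p \<Longrightarrow> \<Phi> t (\<lambda>k. R * x k) i = 0" by blast
    have "2 * real N + 1 = (\<Sum>j<N. 2)"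
      unfolding RS [OF x, symmetric] total [of "\<lambda>k. R * x k", symmetric]
      using zero [OF t z] by (intro sum.cong) auto
    then show False by simp
  qed
  have \<Phi>G: "\<exists>i\<le>p. (1 - t) * \<Phi> 0 (\<lambda>k. R * x k) i + t * G (\<lambda>k. R * x k) i \<noteq> 0"
    if t: "0 \<le> t" "t \<le> 1" and x: "x \<in> unit_sphere p" for t x
  proof (rule ccontr)
    define v where "v = (\<lambda>k. R * x k)"
    have RSv: "(\<Sum>i\<le>p. (v i)\<^sup>2) = 2 * real N + 1" using RS [OF x] by (simp only: v_def)
    assume "\<not> ?thesis"
    then have z: "\<And>i. i \<le> p \<Longrightarrow> (1 - t) * \<Phi> 0 v i + t * G v i = 0" by (auto simp: v_def)
    have "2 * real N + 1 \<le> (\<Sum>j<N. 2)"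
      unfolding RSv [symmetric] total [of v, symmetric]
    proof (rule sum_mono)
      fix j assume "j \<in> {..<N}"
      then have j: "j < N" by simp
      note D = assemble_zeroD [OF z [unfolded \<Phi>_def G_def assemble_linear ip] j]
      show "(v (slot_mu m j))\<^sup>2 + (\<Sum>c<m. (v (slot_x m j c))\<^sup>2) + (\<Sum>c<m. (v (slot_y m j c))\<^sup>2) + (v (slot_la m j))\<^sup>2 \<le> 2"
        by (rule linear_homotopy_block [OF t D(1) _ _ D(4)]) (use D(2,3) A0 B0 j in auto)
    qed
    then show False by simp
  qed
  have GQ: "\<exists>i\<le>p. (1 - t) * G (\<lambda>k. R * x k) i + t * Q (\<lambda>k. R * x k) i \<noteq> 0"
    if t: "0 \<le> t" "t \<le> 1" and x: "x \<in> unit_sphere p" for t x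
  proof (rule ccontr)
    define v where "v = (\<lambda>k. R * x k)"
    have RSv: "(\<Sum>i\<le>p. (v i)\<^sup>2) = 2 * real N + 1" using RS [OF x] by (simp only: v_def)
    assume "\<not> ?thesis"
    then have "\<And>i. i \<le> p \<Longrightarrow> (1 - t) * G v i + t * Q v i = 0" by (auto simp: v_def)
    then have z: "(1 - t) * G v i + t * assemble m (\<lambda>j. (v (slot_mu m j))\<^sup>2 - (\<Sum>c<m. (v (slot_x m j c))\<^sup>2))
        (\<lambda>j c. v (slot_mu m j) * v (slot_x m j c)) (\<lambda>j c. v (slot_y m j c)) (\<lambda>j. v (slot_la m j)) i = 0"
      if "i < N * (2 * m + 2)" for i
      using that double_blocks_eq_assemble [OF that, of v] unfolding Q_def ip by metis
    have "2 * real N + 1 = (\<Sum>j<N. 0)"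
      unfolding RSv [symmetric] total [of v, symmetric]
    proof (rule sum.cong)
      fix j assume "j \<in> {..<N}"
      then have j: "j < N" by simp
      note D = assemble_zeroD [OF z [unfolded G_def assemble_linear] j]
      show "(v (slot_mu m j))\<^sup>2 + (\<Sum>c<m. (v (slot_x m j c))\<^sup>2) + (\<Sum>c<m. (v (slot_y m j c))\<^sup>2) + (v (slot_la m j))\<^sup>2 = 0"
        by (rule shear_homotopy_block [OF D(1) D(2) D(3) D(4)])
    qed simp
    then show False by simp
  qed
  have "even (m + 1)" "0 < m + 1" "m + 1 \<le> 2 * m + 2" using m by auto
  note deg = degree_double_blocks [OF this, of N p, folded Q_def]
  have nzQ: "\<exists>i\<le>p. Q v i \<noteq> 0" if "\<exists>i\<le>p. v i \<noteq> 0" for v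
    using deg that p by simp
  have "Brouwer_degree2 p (\<lambda>x. radial p (\<Phi> 1 (\<lambda>k. R * x k))) = Brouwer_degree2 p (\<lambda>x. radial p (\<Phi> 0 (\<lambda>k. R * x k)))"
  proof (rule degree_radial_homotopy [where H = "\<lambda>t x. \<Phi> t (\<lambda>k. R * x k)", symmetric])
    fix i assume "i \<le> p"
    show "continuous_on ({0..1} \<times> unit_sphere p) (\<lambda>z. \<Phi> (fst z) (\<lambda>k. R * snd z k) i)"
    proof (rule continuous_on_compose2 [OF \<Phi>c [OF \<open>i \<le> p\<close>], where f = "\<lambda>z. (fst z, (\<lambda>k. R * snd z k))", simplified])
      show "continuous_on ({0..1::real} \<times> unit_sphere p) (\<lambda>z. (fst z, (\<lambda>k. R * snd z k)))"
        by (intro continuous_on_Pair continuous_on_fst continuous_on_id continuous_on_coordinatewise_then_product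
            continuous_on_mult continuous_on_const cc)
    qed auto
  qed (use \<Phi>R in blast)
  also have "\<dots> = Brouwer_degree2 p (\<lambda>x. radial p (G (\<lambda>k. R * x k)))"
  proof (rule degree_radial_linear_homotopy)
    fix i assume i: "i \<le> p"
    show "continuous_on (unit_sphere p) (\<lambda>x. \<Phi> 0 (\<lambda>k. R * x k) i)"
      by (rule continuous_on_compose2 [OF \<Phi>c [OF i], where f = "\<lambda>x. (0, (\<lambda>k. R * x k))", simplified])
        (intro continuous_on_Pair continuous_on_const cR, force)
    show "continuous_on (unit_sphere p) (\<lambda>x. G (\<lambda>k. R * x k) i)"
      by (rule continuous_on_compose2 [OF Gc [OF i, of UNIV] cR]) simp
  qed (use \<Phi>G in blast)
  also have "\<dots> = Brouwer_degree2 p (\<lambda>x. radial p (Q (\<lambda>k. R * x k)))"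
  proof (rule degree_radial_linear_homotopy)
    fix i assume i: "i \<le> p"
    show "continuous_on (unit_sphere p) (\<lambda>x. G (\<lambda>k. R * x k) i)"
      by (rule continuous_on_compose2 [OF Gc [OF i, of UNIV] cR]) simp
    show "continuous_on (unit_sphere p) (\<lambda>x. Q (\<lambda>k. R * x k) i)"
      by (rule continuous_on_compose2 [OF Qc [of UNIV] cR]) simp
  qed (use GQ in blast)
  also have "\<dots> = Brouwer_degree2 p (\<lambda>x. radial p (Q x))"
  proof -
    \<comment> \<open>Among the coordinates of the blocks \<open>Q\<close> vanishes only at the
      origin, so the radius can be moved from \<open>R\<close> to 1.\<close>
    have R0: "R > 0" by (simp add: R_def)
    have "Brouwer_degree2 p (\<lambda>x. radial p (Q (\<lambda>k. ((1 - 0) * R + 0) * x k))) = Brouwer_degree2 p (\<lambda>x. radial p (Q (\<lambda>k. ((1 - 1) * R + 1) * x k)))"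
    proof (rule degree_radial_homotopy [where H = "\<lambda>t x. Q (\<lambda>k. ((1 - t) * R + t) * x k)"])
      fix i
      show "continuous_on ({0..1} \<times> unit_sphere p) (\<lambda>z. Q (\<lambda>k. ((1 - fst z) * R + fst z) * snd z k) i)"
        by (rule continuous_on_compose2 [OF Qc [of UNIV]])
          (intro continuous_on_coordinatewise_then_product continuous_on_add continuous_on_mult continuous_on_diff
            continuous_on_const continuous_on_fst continuous_on_id cc, simp)
    next
      fix t :: real and x assume t: "0 \<le> t" "t \<le> 1" and x: "x \<in> unit_sphere p"
      have "(1 - t) * R \<ge> 0" using t R0 by simp
      then have "(1 - t) * R + t \<noteq> 0" using t R0 by (cases "t = 0") (simp, linarith)
      then show "\<exists>i\<le>p. Q (\<lambda>k. ((1 - t) * R + t) * x k) i \<noteq> 0"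
        using unit_sphere_nonzero [OF x] by (intro nzQ) auto
    qed
    then show ?thesis by simp
  qed
  also have "\<dots> = 2 ^ N" using deg p by simp
  finally have d: "Brouwer_degree2 p (\<lambda>x. radial p (\<Phi> 1 (\<lambda>k. R * x k))) = 2 ^ N" .
  have "\<exists>t x. 0 \<le> t \<and> t \<le> 1 \<and> x \<in> unit_sphere p \<and> (\<forall>i\<le>p. \<Phi> 1 (\<lambda>k. t * R * x k) i = 0)"
  proof (rule ccontr)
    assume n: "\<not> ?thesis"
    have "Brouwer_degree2 p (\<lambda>x. radial p (\<Phi> 1 (\<lambda>k. R * x k))) = 0"
    proof (rule degree_radial_zero_free)
      fix i assume i: "i \<le> p"
      show "continuous_on UNIV (\<lambda>x. \<Phi> 1 x i)"
        by (rule continuous_on_compose2 [OF \<Phi>c [OF i], where f = "\<lambda>x. (1, x)", simplified])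
          (intro continuous_intros, force)
    qed (use n in blast)
    with d show False by simp
  qed
  then obtain t x where x: "x \<in> unit_sphere p" and z: "\<And>i. i \<le> p \<Longrightarrow> \<Phi> 1 (\<lambda>k. t * R * x k) i = 0" by blast
  have "x i = 0" if "i \<ge> N * (2 * m + 2)" for i
    using x that p by (simp add: unit_sphere_def)
  with zero [OF _ _ z] that [of "\<lambda>k. t * R * x k"] show thesis by simp
qed

section \<open>Continuous families of paths\<close>

text \<open>The evaluation half of the exponential law, resting on local compactness of the
  interval: a compact neighbourhood \<open>K\<close> of the time \<open>t\<close> is sent into
  \<open>V\<close>, and sending \<open>K\<close> into \<open>V\<close> is an open condition on the
  path.\<close>

lemma continuous_map_path_space_eval:
  assumes f: "continuous_map Z (path_space X) f"
  shows "continuous_map (prod_topology Z (top_of_set {0..1})) X (\<lambda>(z, t). f z t)"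
proof -
  have fz: "continuous_map (top_of_set {0..1}) X (f z)" if "z \<in> topspace Z" for z
    using continuous_map_image_subset_topspace [OF f] that
    by (auto simp: path_space_def mapping_set_def)
  have W: "openin Z {z \<in> topspace Z. f z ` K \<subseteq> V}" if "compact K" "K \<subseteq> {0..1}" "openin X V" for K V
  proof -
    have "openin (path_space X) {g \<in> mapping_set (top_of_set {0..1}) X. g ` K \<subseteq> V}"
      unfolding path_space_def compact_open_topology_def
      using that by (intro topology_generated_by_Basis) (auto simp: compactin_subtopology)
    then have "openin Z {z \<in> topspace Z. f z \<in> {g \<in> mapping_set (top_of_set {0..1}) X. g ` K \<subseteq> V}}"
      by (rule openin_continuous_map_preimage [OF f])
    moreover have "f z \<in> mapping_set (top_of_set {0..1}) X" if "z \<in> topspace Z" for z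
      using continuous_map_image_subset_topspace [OF f] that by (auto simp: path_space_def)
    ultimately show ?thesis by (auto elim!: back_subst [of "openin Z"])
  qed
  show ?thesis
    unfolding continuous_map_def
  proof (intro conjI allI impI)
    show "(\<lambda>(z, t). f z t) \<in> topspace (prod_topology Z (top_of_set {0..1})) \<rightarrow> topspace X"
      using fz by (fastforce simp: continuous_map_def Pi_iff)
  next
    fix V assume V: "openin X V"
    let ?S = "{p \<in> topspace (prod_topology Z (top_of_set {0..1})). (case p of (z, t) \<Rightarrow> f z t) \<in> V}"
    show "openin (prod_topology Z (top_of_set {0..1})) ?S"
    proof (subst openin_subopen, intro ballI)
      fix p assume "p \<in> ?S"
      then obtain z t where p: "p = (z, t)" and z: "z \<in> topspace Z" and t: "t \<in> {0..1}" and ft: "f z t \<in> V"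
        by auto
      have "openin (top_of_set {0..1}) {\<tau> \<in> {0..1}. f z \<tau> \<in> V}"
        using openin_continuous_map_preimage [OF fz [OF z] V] by simp
      then obtain e where e: "e > 0" "ball t e \<inter> {0..1} \<subseteq> {\<tau> \<in> {0..1}. f z \<tau> \<in> V}"
        using t ft unfolding openin_contains_ball by auto
      define K where "K = cball t (e / 2) \<inter> {0..1}"
      have KV: "f z ` K \<subseteq> V" using e by (auto simp: K_def subset_iff)
      have "compact K" unfolding K_def by (intro compact_Int_closed) auto
      let ?T = "{z \<in> topspace Z. f z ` K \<subseteq> V} \<times> (ball t (e / 2) \<inter> {0..1})"
      have "openin (prod_topology Z (top_of_set {0..1})) ?T"
        unfolding openin_prod_Times_iff
        using W [OF \<open>compact K\<close> _ V] by (auto simp: K_def openin_open)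
      moreover have "p \<in> ?T" using p z t KV e by auto
      moreover have "?T \<subseteq> ?S" by (auto simp: K_def)
      ultimately show "\<exists>T. openin (prod_topology Z (top_of_set {0..1})) T \<and> p \<in> T \<and> T \<subseteq> ?S" by blast
    qed
  qed
qed

text \<open>The other half of the exponential law. The parameters whose path leaves \<open>V\<close>
  at some time in \<open>K\<close> form the projection of a closed set along the compact interval,
  hence a closed set.\<close>

lemma continuous_map_path_space_curry:
  assumes g: "continuous_map (prod_topology Z (top_of_set {0..1})) X g"
  shows "continuous_map Z (path_space X) (\<lambda>z. \<lambda>t\<in>{0..1}. g (z, t))"
  unfolding path_space_def compact_open_topology_def
proof (rule continuous_on_generated_topo)
  let ?c = "\<lambda>z. \<lambda>t\<in>{0..1::real}. g (z, t)"
  have mem: "?c z \<in> mapping_set (top_of_set {0..1::real}) X" if z: "z \<in> topspace Z" for z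
  proof -
    have "continuous_map (top_of_set {0..1::real}) (prod_topology Z (top_of_set {0..1::real})) (\<lambda>t. (z, t))"
      using z by (simp add: continuous_map_pairedI)
    from continuous_map_compose [OF this g] have "continuous_map (top_of_set {0..1::real}) X (?c z)"
      by (rule continuous_map_eq) simp
    then show ?thesis by (simp add: mapping_set_def)
  qed
  \<comment> \<open>The subbasic set for the empty compact set is the whole mapping set, so the
    subbasis covers it.\<close>
  have "{h \<in> mapping_set (top_of_set {0..1::real}) X. h ` {} \<subseteq> {}}
      \<in> {{f \<in> mapping_set (top_of_set {0..1::real}) X. f ` K \<subseteq> V} | K V. compactin (top_of_set {0..1::real}) K \<and> openin X V}"
    by blast
  then show "?c ` topspace Z \<subseteq> \<Union> {{f \<in> mapping_set (top_of_set {0..1::real}) X. f ` K \<subseteq> V} | K V.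
      compactin (top_of_set {0..1::real}) K \<and> openin X V}"
    using mem by blast
  fix U assume "U \<in> {{f \<in> mapping_set (top_of_set {0..1::real}) X. f ` K \<subseteq> V} | K V.
      compactin (top_of_set {0..1::real}) K \<and> openin X V}"
  then obtain K V where U: "U = {f \<in> mapping_set (top_of_set {0..1::real}) X. f ` K \<subseteq> V}"
    and K: "compact K" "K \<subseteq> {0..1}" and V: "openin X V"
    by (auto simp: compactin_subtopology)
  let ?P = "prod_topology Z (top_of_set {0..1::real})"
  have "closedin ?P {p \<in> topspace ?P. g p \<in> topspace X - V}"
    using V by (intro closedin_continuous_map_preimage [OF g]) auto
  moreover have "closedin ?P (topspace Z \<times> K)"
    using K by (auto simp: closedin_prod_Times_iff closed_subset compact_imp_closed)
  ultimately have "closedin ?P ({p \<in> topspace ?P. g p \<in> topspace X - V} \<inter> (topspace Z \<times> K))"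
    by (rule closedin_Int)
  moreover have "closed_map ?P Z fst"
    by (intro closed_map_fst) (simp add: compact_space_subtopology)
  ultimately have "closedin Z (fst ` ({p \<in> topspace ?P. g p \<in> topspace X - V} \<inter> (topspace Z \<times> K)))"
    by (simp add: closed_map_def)
  then have "openin Z (topspace Z - fst ` ({p \<in> topspace ?P. g p \<in> topspace X - V} \<inter> (topspace Z \<times> K)))"
    by blast
  also have "topspace Z - fst ` ({p \<in> topspace ?P. g p \<in> topspace X - V} \<inter> (topspace Z \<times> K)) = ?c -` U \<inter> topspace Z"
  proof -
    have gX: "g (z, t) \<in> topspace X" if "z \<in> topspace Z" "t \<in> K" for z t
      using continuous_map_image_subset_topspace [OF g] that K by auto
    have "?c -` U \<inter> topspace Z = {z \<in> topspace Z. \<forall>t\<in>K. g (z, t) \<in> V}"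
      using mem K by (auto simp: U subset_iff)
    moreover have "z \<in> fst ` ({p \<in> topspace ?P. g p \<in> topspace X - V} \<inter> (topspace Z \<times> K)) \<longleftrightarrow>
        (\<exists>t\<in>K. g (z, t) \<notin> V)" if "z \<in> topspace Z" for z
    proof
      assume "z \<in> fst ` ({p \<in> topspace ?P. g p \<in> topspace X - V} \<inter> (topspace Z \<times> K))"
      then show "\<exists>t\<in>K. g (z, t) \<notin> V" by auto
    next
      assume "\<exists>t\<in>K. g (z, t) \<notin> V"
      then obtain t where "t \<in> K" "g (z, t) \<notin> V" by blast
      then have "(z, t) \<in> {p \<in> topspace ?P. g p \<in> topspace X - V} \<inter> (topspace Z \<times> K)"
        using that K gX by auto
      from imageI [OF this, of fst]
      show "z \<in> fst ` ({p \<in> topspace ?P. g p \<in> topspace X - V} \<inter> (topspace Z \<times> K))" by simp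
    qed
    ultimately show ?thesis by blast
  qed
  finally show "openin Z (?c -` U \<inter> topspace Z)" .
qed

section \<open>The lower bound\<close>

lemma topspace_configuration_space:
  "topspace (configuration_space n (euclidean :: 'a::topological_space topology)) =
     {x \<in> extensional {1..n}. \<forall>i\<in>{1..n}. \<forall>j\<in>{1..n}. i \<noteq> j \<longrightarrow> x i \<noteq> x j}"
  by (auto simp: configuration_space_def PiE_def)

lemma continuous_map_configuration_projection:
  "k \<in> {1..n} \<Longrightarrow> continuous_map (configuration_space n X) X (\<lambda>x. x k)"
  unfolding configuration_space_def
  by (intro continuous_map_from_subtopology continuous_map_product_projection)

lemma continuous_map_into_configuration_space:
  fixes f :: "'z \<Rightarrow> nat \<Rightarrow> 'a::topological_space"
  assumes "\<And>z. z \<in> topspace Z \<Longrightarrow> f z \<in> topspace (configuration_space n euclidean)"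
    and "\<And>k. k \<in> {1..n} \<Longrightarrow> continuous_map Z euclidean (\<lambda>z. f z k)"
  shows "continuous_map Z (configuration_space n (euclidean :: 'a topology)) f"
  unfolding configuration_space_def continuous_map_in_subtopology continuous_map_componentwise
  using assms by (auto simp: topspace_configuration_space)

section \<open>The product of spheres in the configuration space\<close>

definition planetary :: "nat \<Rightarrow> (nat \<Rightarrow> 'a::real_normed_vector) \<Rightarrow> nat \<Rightarrow> 'a" where
  "planetary n w = (\<lambda>k\<in>{1..n}. if k = 1 then 0 else 3 ^ k *\<^sub>R sgn (w (k - 2)))"

lemma norm_planetary:
  assumes "k \<in> {1..n}" "k \<noteq> 1 \<Longrightarrow> w (k - 2) \<noteq> 0"
  shows "norm (planetary n w k) = (if k = 1 then 0 else 3 ^ k)"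
  using assms by (simp add: planetary_def norm_sgn)

text \<open>The points lie at pairwise different distances 0, 9, 27, ... from the origin, so no
  choice of directions makes two of them meet. Point \<open>k\<close> \<ge> 2 takes its direction
  from entry \<open>k - 2\<close>, which leaves \<open>n - 1\<close> free directions.\<close>

lemma planetary_in_configuration_space:
  fixes w :: "nat \<Rightarrow> 'a::real_normed_vector"
  assumes w: "\<And>j. j < n - 1 \<Longrightarrow> w j \<noteq> 0"
  shows "planetary n w \<in> topspace (configuration_space n euclidean)"
proof -
  have w': "w (k - 2) \<noteq> 0" if "k \<in> {1..n}" "k \<noteq> 1" for k using that by (intro w) auto
  have "planetary n w k \<noteq> planetary n w l" if "k \<in> {1..n}" "l \<in> {1..n}" "k \<noteq> l" for k l
  proof
    assume "planetary n w k = planetary n w l"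
    then have "norm (planetary n w k) = norm (planetary n w l)" by simp
    then show False
      using norm_planetary [of k n w] norm_planetary [of l n w] that w'
      by (auto split: if_splits)
  qed
  then show ?thesis
    by (auto simp: topspace_configuration_space planetary_def)
qed

lemma continuous_map_planetary:
  fixes w :: "'z::topological_space \<Rightarrow> nat \<Rightarrow> 'a::real_normed_vector"
  assumes w: "\<And>j z. j < n - 1 \<Longrightarrow> z \<in> S \<Longrightarrow> w z j \<noteq> 0"
    and c: "\<And>j. j < n - 1 \<Longrightarrow> continuous_on S (\<lambda>z. w z j)"
  shows "continuous_map (top_of_set S) (configuration_space n euclidean) (\<lambda>z. planetary n (w z))"
proof (rule continuous_map_into_configuration_space)
  show "planetary n (w z) \<in> topspace (configuration_space n euclidean)" if "z \<in> topspace (top_of_set S)" for z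
    using that w by (intro planetary_in_configuration_space) auto
  fix k assume k: "k \<in> {1..n}"
  have "continuous_on S (\<lambda>z. planetary n (w z) k)"
  proof (cases "k = 1")
    case False
    then have "k - 2 < n - 1" using k by auto
    then have "continuous_on S (\<lambda>z. 3 ^ k *\<^sub>R sgn (w z (k - 2)))"
      using w c by (intro continuous_intros) auto
    then show ?thesis using k False by (simp add: planetary_def)
  qed (use k in \<open>simp add: planetary_def\<close>)
  then show "continuous_map (top_of_set S) euclidean (\<lambda>z. planetary n (w z) k)" by simp
qed

text \<open>The clock of \<open>h\<close> is slowed down near the complement of \<Omega> and stopped
  in a collar around it. The result extends by \<open>x\<close>, and still runs to the end wherever
  the ball of radius \<delta> fits into \<Omega>.\<close>

lemma homotopy_cutoff:
  fixes \<Omega> :: "'a::metric_space set" and h :: "'a \<Rightarrow> real \<Rightarrow> 'b::real_normed_vector"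
  assumes \<Omega>: "open \<Omega>" "\<Omega> \<noteq> UNIV" and \<delta>: "\<delta> > 0"
    and h: "continuous_on (\<Omega> \<times> {0..1}) (\<lambda>(v, t). h v t)" and x: "continuous_on UNIV x"
    and h0: "\<And>v. v \<in> \<Omega> \<Longrightarrow> h v 0 = x v"
    and hn: "\<And>v t. \<lbrakk>v \<in> \<Omega>; 0 \<le> t; t \<le> 1\<rbrakk> \<Longrightarrow> norm (h v t) = norm (x v)"
  obtains a :: "real \<Rightarrow> 'a \<Rightarrow> 'b"
  where "continuous_on UNIV (\<lambda>z. a (fst z) (snd z))" "\<And>v. a 0 v = x v" "\<And>t v. norm (a t v) = norm (x v)"
    "\<And>v. ball v \<delta> \<subseteq> \<Omega> \<Longrightarrow> a 1 v = h v 1"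
proof -
  \<comment> \<open>Equals 0 up to distance \<delta>/2 from the complement and 1 from distance
    \<delta> on.\<close>
  define \<kappa> where "\<kappa> v = min 1 (max 0 (2 * infdist v (- \<Omega>) / \<delta> - 1))" for v
  define \<tau> where "\<tau> t v = min 1 (max 0 t) * \<kappa> v" for t :: real and v
  define a where "a t v = (if v \<in> \<Omega> then h v (\<tau> t v) else x v)" for t v
  have \<kappa>c: "continuous_on S \<kappa>" for S
    unfolding \<kappa>_def using \<delta> by (intro continuous_intros) auto
  have \<tau>c: "continuous_on S (\<lambda>z. \<tau> (fst z) (snd z))" for S
    unfolding \<tau>_def by (intro continuous_intros continuous_on_compose2 [OF \<kappa>c [of UNIV]]) auto
  have \<tau>01: "0 \<le> \<tau> t v" "\<tau> t v \<le> 1" for t v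
    by (auto simp: \<tau>_def \<kappa>_def intro!: mult_nonneg_nonneg mult_le_one)
  let ?V = "{v. infdist v (- \<Omega>) < \<delta> / 2}"
  have V: "open ?V" by (intro open_Collect_less continuous_intros)
  have aV: "a t v = x v" if "v \<in> ?V" for t v
  proof -
    have "2 * infdist v (- \<Omega>) / \<delta> - 1 \<le> 0" using that \<delta> by (simp add: field_simps)
    then have "\<tau> t v = 0" by (simp add: \<tau>_def \<kappa>_def)
    then show ?thesis by (simp add: a_def h0)
  qed
  have "continuous_on ((UNIV \<times> \<Omega>) \<union> (UNIV \<times> ?V)) (\<lambda>z. a (fst z) (snd z))"
  proof (rule continuous_on_open_Un)
    have "continuous_on (UNIV \<times> \<Omega>) (\<lambda>z. h (snd z) (\<tau> (fst z) (snd z)))"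
      by (rule continuous_on_compose2 [OF h, where f = "\<lambda>z. (snd z, \<tau> (fst z) (snd z))", simplified])
        (use \<tau>01 in \<open>auto intro!: continuous_intros \<tau>c\<close>)
    then show "continuous_on (UNIV \<times> \<Omega>) (\<lambda>z. a (fst z) (snd z))"
      by (rule continuous_on_eq) (auto simp: a_def)
    have "continuous_on (UNIV \<times> ?V) (\<lambda>z. x (snd z))"
      by (intro continuous_on_compose2 [OF x] continuous_intros) auto
    then show "continuous_on (UNIV \<times> ?V) (\<lambda>z. a (fst z) (snd z))"
      by (rule continuous_on_eq) (use aV in auto)
  qed (intro open_Times open_UNIV \<Omega> V)+
  moreover have "(UNIV \<times> \<Omega>) \<union> (UNIV \<times> ?V) = (UNIV :: (real \<times> 'a) set)"
  proof -
    have "v \<in> ?V" if "v \<notin> \<Omega>" for v using that \<delta> by (simp add: infdist_zero)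
    then have "\<Omega> \<union> ?V = UNIV" by blast
    then show ?thesis by (simp only: Sigma_Un_distrib2 [symmetric] UNIV_Times_UNIV)
  qed
  ultimately have c: "continuous_on UNIV (\<lambda>z. a (fst z) (snd z))" by simp
  have "a 1 v = h v 1" if b: "ball v \<delta> \<subseteq> \<Omega>" for v
  proof -
    have "v \<in> \<Omega>" using b \<delta> by auto
    \<comment> \<open>By convention \<open>infdist\<close> to the empty set is 0; here the
      complement of \<Omega> is nonempty by hypothesis.\<close>
    have "infdist v (- \<Omega>) \<ge> \<delta>"
    proof -
      have "\<delta> \<le> dist v w" if "w \<in> - \<Omega>" for w
        using b that by (meson ComplD linorder_not_le mem_ball subsetD)
      then show ?thesis
        using \<Omega> by (auto simp: infdist_def intro!: cINF_greatest)
    qed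
    then have "2 * infdist v (- \<Omega>) / \<delta> - 1 \<ge> 1" using \<delta> by (simp add: field_simps)
    then have "\<tau> 1 v = 1" by (simp add: \<tau>_def \<kappa>_def)
    then show ?thesis using \<open>v \<in> \<Omega>\<close> by (simp add: a_def)
  qed
  moreover have "a 0 v = x v" for v by (simp add: a_def h0 \<tau>_def)
  moreover have "norm (a t v) = norm (x v)" for t v using \<tau>01 by (simp add: a_def hn)
  ultimately show thesis using that c by blast
qed

text \<open>Tychonoff: the type \<open>nat \<Rightarrow> real\<close> carries the product topology,
  and the set is a product of compact intervals.\<close>

lemma compact_bounded_sequences:
  fixes b :: real
  shows "compact {v :: nat \<Rightarrow> real. (\<forall>i. \<bar>v i\<bar> \<le> b)}"
proof -
  have "compactin (product_topology (\<lambda>_. euclideanreal) UNIV) (PiE UNIV (\<lambda>i::nat. {- b..b}))"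
    by (simp add: compactin_PiE)
  moreover have "PiE UNIV (\<lambda>i::nat. {- b..b}) = {v :: nat \<Rightarrow> real. (\<forall>i. \<bar>v i\<bar> \<le> b)}"
    by (auto simp: abs_le_iff minus_le_iff PiE_def Pi_def)
  ultimately show ?thesis by (simp only: euclidean_product_topology compactin_euclidean_iff)
qed

text \<open>The zeros that the coincidence theorem produces lie on this compact product of spheres.\<close>
definition sphere_torus :: "nat \<Rightarrow> nat \<Rightarrow> (nat \<Rightarrow> real) set" where
  "sphere_torus m N = {v. (\<forall>i\<ge>N * (2 * m + 2). v i = 0) \<and>
     (\<forall>j<N. (\<Sum>c<m. (v (slot_x m j c))\<^sup>2) = 1 \<and> (\<Sum>c<m. (v (slot_y m j c))\<^sup>2) = 1 \<and>
        v (slot_mu m j) = 0 \<and> v (slot_la m j) = 0)}"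

lemma compact_sphere_torus: "compact (sphere_torus m N)"
proof -
  have "closed {v :: nat \<Rightarrow> real. f v = b}" if "continuous_on UNIV f" for f and b :: real
    using that by (intro closed_Collect_eq continuous_on_const)
  note cl = this
  have "closed (sphere_torus m N)"
  proof -
    have "sphere_torus m N = (\<Inter>i\<in>{N * (2 * m + 2)..}. {v. v i = 0}) \<inter>
      (\<Inter>j\<in>{..<N}. {v. (\<Sum>c<m. (v (slot_x m j c))\<^sup>2) = 1} \<inter> {v. (\<Sum>c<m. (v (slot_y m j c))\<^sup>2) = 1} \<inter>
        {v. v (slot_mu m j) = 0} \<inter> {v. v (slot_la m j) = 0})"
      unfolding sphere_torus_def by blast
    then show ?thesis
      by (simp only:) (intro closed_Int closed_INT ballI cl continuous_intros continuous_on_coordinate)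
  qed
  moreover have "sphere_torus m N \<subseteq> {v. \<forall>i. \<bar>v i\<bar> \<le> 2 * real N + 1}"
  proof (clarify)
    fix v i assume v: "v \<in> sphere_torus m N"
    show "\<bar>v i\<bar> \<le> 2 * real N + 1"
    proof (cases "i < N * (2 * m + 2)")
      case True
      have "(v i)\<^sup>2 \<le> (\<Sum>i<N * (2 * m + 2). (v i)\<^sup>2)"
        using True by (intro member_le_sum) auto
      also have "\<dots> = (\<Sum>j<N. 2)"
        unfolding sum_blocks using v by (intro sum.cong) (auto simp: sphere_torus_def)
      also have "\<dots> \<le> (2 * real N + 1)\<^sup>2" by (simp add: power2_eq_square algebra_simps)
      finally show ?thesis by (intro abs_le_square_iff [THEN iffD2, of "v i" "2 * real N + 1", simplified]) 
    next
      case False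
      then show ?thesis using v by (simp add: sphere_torus_def)
    qed
  qed
  ultimately show ?thesis
    using compact_Int_closed [OF compact_bounded_sequences] by (metis inf.absorb_iff2)
qed

text \<open>With at most \<open>2 * N\<close> planners, where \<open>N\<close> =
  \<open>n - 1\<close>, one of the maps obtained from them takes both the value
  \<open>y\<^sub>j\<close> and the value \<open>- y\<^sub>j\<close> at the same point, although
  \<open>y\<^sub>j\<close> is a unit vector there.\<close>

lemma motion_planning_cover_configuration_space_ge:
  assumes n: "n \<ge> 2" and odd: "odd CARD('m::finite)"
    and cover: "motion_planning_cover (configuration_space n (euclidean :: (real ^ 'm) topology)) k"
  shows "k \<ge> 2 * n - 1"
proof (rule ccontr)
  assume "\<not> k \<ge> 2 * n - 1"
  define N where "N = n - 1"
  have N: "N > 0" and kN: "k \<le> 2 * N" using n \<open>\<not> k \<ge> 2 * n - 1\<close> by (auto simp: N_def)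
  define m where "m = CARD('m)"
  let ?X = "configuration_space n (euclidean :: (real ^ 'm) topology)"
  obtain U s where U: "\<And>i. i \<in> {1..k} \<Longrightarrow> openin (prod_topology ?X ?X) (U i)"
    and s: "\<And>i. i \<in> {1..k} \<Longrightarrow> local_motion_planner ?X (U i) (s i)"
    and UX: "(\<Union>i\<in>{1..k}. U i) = topspace (prod_topology ?X ?X)"
    using cover unfolding motion_planning_cover_def by metis
  obtain e :: "nat \<Rightarrow> 'm" where e: "bij_betw e {..<m} UNIV"
    using ex_bij_betw_nat_finite [of "UNIV :: 'm set"] by (auto simp: m_def lessThan_atLeast0)
  define d where "d = inv_into {..<m} e"
  have d: "bij_betw d UNIV {..<m}" and de: "\<And>c. c < m \<Longrightarrow> d (e c) = c"
    using e by (simp_all add: d_def bij_betw_inv_into bij_betw_inv_into_left)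
  define xv where "xv v j = ((\<chi> k. v (slot_x m j (d k))) :: real ^ 'm)" for v :: "nat \<Rightarrow> real" and j
  define yv where "yv v j = ((\<chi> k. v (slot_y m j (d k))) :: real ^ 'm)" for v :: "nat \<Rightarrow> real" and j
  have norm2: "(norm w)\<^sup>2 = (\<Sum>c<m. (w $ e c)\<^sup>2)" for w :: "real ^ 'm"
  proof -
    have "(norm w)\<^sup>2 = (\<Sum>k\<in>UNIV. (w $ k)\<^sup>2)"
      by (simp add: norm_vec_def L2_set_def sum_nonneg)
    also have "\<dots> = (\<Sum>c<m. (w $ e c)\<^sup>2)"
      by (rule sum.reindex_bij_betw [OF e, symmetric])
    finally show ?thesis .
  qed
  have xc: "continuous_on S (\<lambda>v. xv v j)" and yc: "continuous_on S (\<lambda>v. yv v j)" for S j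
    unfolding xv_def yv_def by (intro continuous_on_vec_lambda continuous_on_coordinate)+
  define O' where "O' = {v. \<forall>j<N. xv v j \<noteq> 0 \<and> yv v j \<noteq> 0}"
  have "O' = (\<Inter>j\<in>{..<N}. {v. xv v j \<noteq> 0} \<inter> {v. yv v j \<noteq> 0})" by (auto simp: O'_def)
  then have O': "open O'"
    by (simp only:) (intro open_INT finite_lessThan ballI open_Int open_Collect_neq xc yc continuous_on_const)
  define P where "P v = (planetary n (xv v), planetary n (yv v))" for v
  have Pc: "continuous_map (top_of_set O') (prod_topology ?X ?X) P"
    unfolding P_def
    by (intro continuous_map_pairedI continuous_map_planetary xc yc) (auto simp: O'_def N_def)
  \<comment> \<open>Padding with empty sets makes the number of domains exactly
    \<open>2 * N\<close>, two for each factor.\<close>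
  define \<Omega> where "\<Omega> i = (if i \<le> k then {v \<in> O'. P v \<in> U i} else {})" for i
  have \<Omega>: "open (\<Omega> i)" if "i \<in> {1..2 * N}" for i
  proof (cases "i \<le> k")
    case True
    then have "openin (top_of_set O') {v \<in> topspace (top_of_set O'). P v \<in> U i}"
      using that by (intro openin_continuous_map_preimage [OF Pc] U) auto
    then show ?thesis using True O' by (simp add: \<Omega>_def openin_open_eq)
  qed (simp add: \<Omega>_def)
  \<comment> \<open>The direction from point 1 to point j + 2 along the planned path, scaled to the
    length of \<open>x\<^sub>j\<close>, where j = \<open>(i - 1) div 2\<close> is the factor that
    planner \<open>i\<close> serves. At time 0 this is \<open>x\<^sub>j\<close>, at time 1 it points
    in the direction of \<open>y\<^sub>j\<close>.\<close>
  define h where "h i v t = norm (xv v ((i - 1) div 2)) *\<^sub>R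
      sgn (s i (P v) t ((i - 1) div 2 + 2) - s i (P v) t 1)" for i v t
  have path: "s i (P v) t \<in> topspace ?X" if "i \<in> {1..2 * N}" "v \<in> \<Omega> i" "0 \<le> t" "t \<le> 1" for i v t
  proof -
    have i: "i \<in> {1..k}" "P v \<in> U i" using that by (auto simp: \<Omega>_def split: if_splits)
    then have "P v \<in> topspace (subtopology (prod_topology ?X ?X) (U i))"
      using openin_subset [OF U] by auto
    then have "s i (P v) \<in> topspace (path_space ?X)"
      using s [OF i(1)] continuous_map_image_subset_topspace unfolding local_motion_planner_def by blast
    then have "continuous_map (top_of_set {0..1}) ?X (s i (P v))"
      by (simp add: path_space_def mapping_set_def)
    from continuous_map_image_subset_topspace [OF this] that show ?thesis by auto
  qed
  have idx: "(i - 1) div 2 < N" "(i - 1) div 2 + 2 \<in> {1..n}" "1 \<in> {1..n}" if "i \<in> {1..2 * N}" for i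
    using that n by (auto simp: N_def)
  have ends: "s i (P v) 0 = planetary n (xv v)" "s i (P v) 1 = planetary n (yv v)"
    if "i \<in> {1..2 * N}" "v \<in> \<Omega> i" for i v
  proof -
    have "i \<in> {1..k}" "P v \<in> U i" using that by (auto simp: \<Omega>_def split: if_splits)
    then have "path_ends (s i (P v)) = P v"
      using s unfolding local_motion_planner_def by blast
    then show "s i (P v) 0 = planetary n (xv v)" "s i (P v) 1 = planetary n (yv v)"
      by (simp_all add: path_ends_def P_def)
  qed
  have ne: "s i (P v) t ((i - 1) div 2 + 2) - s i (P v) t 1 \<noteq> 0"
    if "i \<in> {1..2 * N}" "v \<in> \<Omega> i" "0 \<le> t" "t \<le> 1" for i v t
    using path [OF that] idx [OF that(1)] unfolding topspace_configuration_space by auto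
  have hc: "continuous_on (\<Omega> i \<times> {0..1}) (\<lambda>(v, t). h i v t)" if i: "i \<in> {1..2 * N}" for i
  proof (cases "i \<le> k")
    case True
    let ?U = "subtopology (prod_topology ?X ?X) (U i)"
    have "continuous_map (top_of_set (\<Omega> i)) (prod_topology ?X ?X) P"
      using Pc True by (auto simp: \<Omega>_def elim: continuous_map_from_subtopology_mono)
    then have "continuous_map (top_of_set (\<Omega> i)) ?U P"
      using True by (auto simp: continuous_map_in_subtopology \<Omega>_def)
    moreover have "continuous_map ?U (path_space ?X) (s i)"
      using s [of i] i True by (simp add: local_motion_planner_def)
    ultimately have "continuous_map (top_of_set (\<Omega> i)) (path_space ?X) (s i \<circ> P)"
      by (rule continuous_map_compose)
    from continuous_map_path_space_eval [OF this]
    have ev: "continuous_map (top_of_set (\<Omega> i \<times> {0..1})) ?X (\<lambda>(v, t). s i (P v) t)"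
      by (simp only: prod_topology_subtopology_eu o_apply)
    have sc: "continuous_on (\<Omega> i \<times> {0..1}) (\<lambda>z. s i (P (fst z)) (snd z) l)" if "l \<in> {1..n}" for l
      using continuous_map_compose [OF ev continuous_map_configuration_projection [OF that]]
      by (simp add: o_def case_prod_unfold)
    have "continuous_on (\<Omega> i \<times> {0..1}) (\<lambda>z. h i (fst z) (snd z))"
      unfolding h_def
    proof (intro continuous_on_scaleR continuous_on_norm continuous_on_sgn continuous_on_diff sc idx [OF i])
      show "continuous_on (\<Omega> i \<times> {0..1}) (\<lambda>z. xv (fst z) ((i - 1) div 2))"
        by (rule continuous_on_compose2 [OF xc [of UNIV]]) (auto intro: continuous_intros)
    qed (use ne [OF i] in auto)
    then show ?thesis by (simp add: case_prod_unfold)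
  qed (simp add: \<Omega>_def)
  have sg: "sgn (r *\<^sub>R sgn w) = sgn w" if "r > 0" for r and w :: "real ^ 'm"
    using that by (cases "w = 0") (simp_all add: sgn_scaleR sgn_div_norm [of "sgn w"] norm_sgn)
  have nsg: "norm w *\<^sub>R sgn w = w" for w :: "real ^ 'm"
    by (cases "w = 0") (simp_all add: sgn_div_norm)
  have h0: "h i v 0 = xv v ((i - 1) div 2)" and h1: "h i v 1 = norm (xv v ((i - 1) div 2)) *\<^sub>R sgn (yv v ((i - 1) div 2))"
    if "i \<in> {1..2 * N}" "v \<in> \<Omega> i" for i v
  proof -
    have "planetary n w ((i - 1) div 2 + 2) - planetary n w 1 = 3 ^ ((i - 1) div 2 + 2) *\<^sub>R sgn (w ((i - 1) div 2))"
      for w :: "nat \<Rightarrow> real ^ 'm"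
      using idx [OF that(1)] by (simp add: planetary_def)
    note pl = this
    show "h i v 0 = xv v ((i - 1) div 2)"
      unfolding h_def ends [OF that] pl by (subst sg) (simp_all add: nsg)
    show "h i v 1 = norm (xv v ((i - 1) div 2)) *\<^sub>R sgn (yv v ((i - 1) div 2))"
      unfolding h_def ends [OF that] pl by (subst sg) simp_all
  qed
  have hn: "norm (h i v t) = norm (xv v ((i - 1) div 2))" if "i \<in> {1..2 * N}" "v \<in> \<Omega> i" "0 \<le> t" "t \<le> 1" for i v t
    using ne [OF that] by (simp add: h_def norm_sgn)
  have nx: "norm (xv v j) = 1" and ny: "norm (yv v j) = 1" if "v \<in> sphere_torus m N" "j < N" for v j
  proof -
    have "(norm (xv v j))\<^sup>2 = 1" "(norm (yv v j))\<^sup>2 = 1"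
      using that by (simp_all add: norm2 xv_def yv_def de sphere_torus_def cong: sum.cong_simp)
    then show "norm (xv v j) = 1" "norm (yv v j) = 1"
      by (metis norm_ge_zero power2_eq_imp_eq one_power2 zero_le_one)+
  qed
  have "sphere_torus m N \<subseteq> \<Union>(\<Omega> ` {1..2 * N})"
  proof
    fix v assume v: "v \<in> sphere_torus m N"
    have vO: "v \<in> O'" using nx [OF v] ny [OF v] by (force simp: O'_def)
    then have "P v \<in> topspace (prod_topology ?X ?X)"
      using continuous_map_image_subset_topspace [OF Pc] by auto
    then obtain i where "i \<in> {1..k}" "P v \<in> U i" using UX by blast
    then have "i \<in> {1..2 * N}" "v \<in> \<Omega> i" using kN vO by (auto simp: \<Omega>_def)
    then show "v \<in> \<Union>(\<Omega> ` {1..2 * N})" by blast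
  qed
  \<comment> \<open>A Lebesgue number of the cover: around each point of the torus the ball of
    radius \<delta> lies in one of the domains.\<close>
  then obtain \<delta> where \<delta>: "\<delta> > 0" and cov: "\<And>v. v \<in> sphere_torus m N \<Longrightarrow> \<exists>G\<in>\<Omega> ` {1..2 * N}. ball v \<delta> \<subseteq> G"
    using Heine_Borel_lemma [OF compact_sphere_torus, of m N "\<Omega> ` {1..2 * N}"] \<Omega> by blast
  define follows where "follows i a \<longleftrightarrow> continuous_on UNIV (\<lambda>z. a (fst z) (snd z)) \<and>
      (\<forall>v. a 0 v = xv v ((i - 1) div 2)) \<and> (\<forall>t v. norm (a t v) = norm (xv v ((i - 1) div 2))) \<and>
      (\<forall>v. ball v \<delta> \<subseteq> \<Omega> i \<longrightarrow> a 1 v = h i v 1)" for i and a :: "real \<Rightarrow> (nat \<Rightarrow> real) \<Rightarrow> real ^ 'm"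
  have "\<exists>a. follows i a" if i: "i \<in> {1..2 * N}" for i
  proof -
    have "(\<lambda>_. 0) \<notin> O'" using N by (auto simp: O'_def xv_def vec_eq_iff)
    then have "\<Omega> i \<noteq> UNIV" by (auto simp: \<Omega>_def)
    then obtain a :: "real \<Rightarrow> (nat \<Rightarrow> real) \<Rightarrow> real ^ 'm" where
      "continuous_on UNIV (\<lambda>z. a (fst z) (snd z))" "\<And>v. a 0 v = xv v ((i - 1) div 2)"
      "\<And>t v. norm (a t v) = norm (xv v ((i - 1) div 2))" "\<And>v. ball v \<delta> \<subseteq> \<Omega> i \<Longrightarrow> a 1 v = h i v 1"
      by (rule homotopy_cutoff [OF \<Omega> [OF i] _ \<delta> hc [OF i] xc h0 [OF i] hn [OF i]]) blast+
    then show ?thesis unfolding follows_def by blast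
  qed
  then obtain a where "\<And>i. i \<in> {1..2 * N} \<Longrightarrow> follows i (a i)" by metis
  then have ac: "\<And>i. i \<in> {1..2 * N} \<Longrightarrow> continuous_on UNIV (\<lambda>z. a i (fst z) (snd z))"
    and a0: "\<And>i v. i \<in> {1..2 * N} \<Longrightarrow> a i 0 v = xv v ((i - 1) div 2)"
    and an: "\<And>i t v. i \<in> {1..2 * N} \<Longrightarrow> norm (a i t v) = norm (xv v ((i - 1) div 2))"
    and a1: "\<And>i v. i \<in> {1..2 * N} \<Longrightarrow> ball v \<delta> \<subseteq> \<Omega> i \<Longrightarrow> a i 1 v = h i v 1"
    unfolding follows_def by blast+
  have comp: "continuous_on ({0..1} \<times> UNIV) (\<lambda>z. a i (fst z) (snd z) $ e c)" if "i \<in> {1..2 * N}" for i c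
    by (intro continuous_on_component continuous_on_subset [OF ac [OF that]]) simp
  have sq: "(\<Sum>c<m. (a i t v $ e c)\<^sup>2) = (\<Sum>c<m. (v (slot_x m ((i - 1) div 2) c))\<^sup>2)" if "i \<in> {1..2 * N}" for i t v
    using an [OF that, of t v] norm2 [of "xv v ((i - 1) div 2)"] norm2 [of "a i t v"]
    by (simp add: xv_def de cong: sum.cong_simp)
  have start: "a i 0 v $ e c = v (slot_x m ((i - 1) div 2) c)" if "i \<in> {1..2 * N}" "c < m" for i v c
    using that by (simp add: a0 xv_def de)
  have ij: "2 * j + 1 \<in> {1..2 * N}" "2 * j + 2 \<in> {1..2 * N}" "(2 * j + 1 - 1) div 2 = j" "(2 * j + 2 - 1) div 2 = j"
    if "j < N" for j using that by auto
  obtain v where v0: "\<And>i. i \<ge> N * (2 * m + 2) \<Longrightarrow> v i = 0"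
    and v1: "\<And>j. j < N \<Longrightarrow> (\<Sum>c<m. (v (slot_x m j c))\<^sup>2) = 1 \<and> (\<Sum>c<m. (v (slot_y m j c))\<^sup>2) = 1 \<and>
        v (slot_mu m j) = 0 \<and> v (slot_la m j) = 0"
    and v2: "\<And>j c. \<lbrakk>j < N; c < m\<rbrakk> \<Longrightarrow> a (2 * j + 1) 1 v $ e c = - v (slot_y m j c) \<and>
        a (2 * j + 2) 1 v $ e c = - v (slot_y m j c)"
  proof (rule antipodal_coincidence [OF N, of m "\<lambda>t v j c. a (2 * j + 1) t v $ e c" "\<lambda>t v j c. a (2 * j + 2) t v $ e c"])
    show "odd m" using odd by (simp add: m_def)
    fix j assume j: "j < N"
    show "continuous_on ({0..1} \<times> UNIV) (\<lambda>z. a (2 * j + 1) (fst z) (snd z) $ e c)"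
      "continuous_on ({0..1} \<times> UNIV) (\<lambda>z. a (2 * j + 2) (fst z) (snd z) $ e c)" for c
      by (rule comp [OF ij(1) [OF j]] comp [OF ij(2) [OF j]])+
    show "(\<Sum>c<m. (a (2 * j + 1) t v $ e c)\<^sup>2) = (\<Sum>c<m. (v (slot_x m j c))\<^sup>2)"
      "(\<Sum>c<m. (a (2 * j + 2) t v $ e c)\<^sup>2) = (\<Sum>c<m. (v (slot_x m j c))\<^sup>2)" for t v
      using sq [OF ij(1) [OF j]] sq [OF ij(2) [OF j]] unfolding ij(3,4) [OF j] by blast+
    show "a (2 * j + 1) 0 v $ e c = v (slot_x m j c)" "a (2 * j + 2) 0 v $ e c = v (slot_x m j c)"
      if "c < m" for v c
      using start [OF ij(1) [OF j] that] start [OF ij(2) [OF j] that] unfolding ij(3,4) [OF j] by blast+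
  qed blast
  have v: "v \<in> sphere_torus m N" using v0 v1 by (simp add: sphere_torus_def)
  then obtain i where i: "i \<in> {1..2 * N}" and ball: "ball v \<delta> \<subseteq> \<Omega> i" using cov by blast
  define j where "j = (i - 1) div 2"
  have j: "j < N" using idx(1) [OF i] by (simp add: j_def)
  have vi: "v \<in> \<Omega> i" using ball \<delta> by auto
  \<comment> \<open>Planner \<open>i\<close> runs to the end at \<open>v\<close>, so
    \<open>a i 1 v\<close> is \<open>y\<^sub>j\<close>; by the choice of \<open>v\<close> it is also
    \<open>- y\<^sub>j\<close>.\<close>
  have "a i 1 v = yv v j"
    using a1 [OF i ball] h1 [OF i vi] nx [OF v j] ny [OF v j] by (simp add: j_def sgn_div_norm)
  moreover have "i = 2 * j + 1 \<or> i = 2 * j + 2" using i unfolding j_def atLeastAtMost_iff by presburger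
  ultimately have "v (slot_y m j c) = - v (slot_y m j c)" if "c < m" for c
    using v2 [OF j that] that by (auto simp: yv_def de)
  then have "(\<Sum>c<m. (v (slot_y m j c))\<^sup>2) = 0" by simp
  then show False using v1 [OF j] by simp
qed

section \<open>The upper bound\<close>

text \<open>Configurations are extensional, so the coordinates outside \<open>{1..n}\<close> are
  constantly \<open>undefined\<close>. The lemma makes open sets and continuous functions of the
  ambient type available on the configuration space.\<close>

lemma continuous_map_configuration_space_euclidean:
  "continuous_map (configuration_space n (euclidean :: 'a::topological_space topology)) euclidean (\<lambda>x. x)"
proof -
  have "continuous_map (configuration_space n (euclidean :: 'a topology)) euclidean (\<lambda>x. x k)" for k
  proof (cases "k \<in> {1..n}")
    case False
    have "continuous_map (configuration_space n (euclidean :: 'a topology)) euclidean (\<lambda>x. undefined)" by simp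
    then show ?thesis
      by (rule continuous_map_eq) (use False in \<open>auto simp: topspace_configuration_space extensional_def\<close>)
  qed (rule continuous_map_configuration_projection)
  then have "continuous_map (configuration_space n (euclidean :: 'a topology)) (product_topology (\<lambda>_. euclidean) UNIV) (\<lambda>x. x)"
    by (simp add: continuous_map_componentwise_UNIV)
  then show ?thesis by (simp add: euclidean_product_topology)
qed

lemma continuous_map_configuration_pairs_euclidean:
  "continuous_map (prod_topology (configuration_space n (euclidean :: 'a::topological_space topology))
     (configuration_space n (euclidean :: 'a topology))) euclidean (\<lambda>p. p)"
proof -
  let ?X = "configuration_space n (euclidean :: 'a topology)"
  have "continuous_map (prod_topology ?X ?X) (prod_topology euclidean euclidean) (\<lambda>p. (fst p, snd p))"
    using continuous_map_compose [OF continuous_map_fst continuous_map_configuration_space_euclidean]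
      continuous_map_compose [OF continuous_map_snd continuous_map_configuration_space_euclidean]
    by (intro continuous_map_pairedI) (auto simp: o_def)
  then show ?thesis by simp
qed

section \<open>Cells given by pairs of equivalence relations\<close>

definition endpoint :: "'a \<times> 'a \<Rightarrow> bool \<Rightarrow> 'a" where
  "endpoint p s = (if s then snd p else fst p)"

text \<open>The index \<open>False\<close> of \<open>G\<close> and of \<open>endpoint\<close> refers to the start, \<open>True\<close> to the goal.  Comparing
  differences across both configurations is what makes cells with the same total number of classes disjoint.\<close>
definition separated_cell :: "nat \<Rightarrow> 'm \<Rightarrow> (bool \<Rightarrow> (nat \<times> nat) set) \<Rightarrow> ((nat \<Rightarrow> real ^ 'm) \<times> (nat \<Rightarrow> real ^ 'm)) set" where
  "separated_cell n k G = {p.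
     (\<forall>s s'. \<forall>a\<in>{1..n}. \<forall>b\<in>{1..n}. \<forall>c\<in>{1..n}. \<forall>d\<in>{1..n}. (a, b) \<in> G s \<longrightarrow> (c, d) \<notin> G s' \<longrightarrow>
        \<bar>endpoint p s a $ k - endpoint p s b $ k\<bar> < \<bar>endpoint p s' c $ k - endpoint p s' d $ k\<bar>) \<and>
     (\<forall>s. \<forall>a\<in>{1..n}. \<forall>b\<in>{1..n}. (a, b) \<in> G s \<longrightarrow> a \<noteq> b \<longrightarrow> (\<exists>i. i \<noteq> k \<and> endpoint p s a $ i \<noteq> endpoint p s b $ i))}"

lemma continuous_on_endpoint: "continuous_on S (\<lambda>p. endpoint p s (a::nat) $ (i::'m::finite) :: real)"
proof -
  have c: "continuous_on S (\<lambda>p. endpoint p s :: nat \<Rightarrow> real ^ 'm)"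
    by (cases s) (auto simp: endpoint_def intro: continuous_intros)
  show ?thesis
    by (rule continuous_on_component [OF continuous_on_product_then_coordinatewise [OF c]])
qed

lemma open_Collect_const_imp: "(P \<Longrightarrow> open {p. Q p}) \<Longrightarrow> open {p. P \<longrightarrow> Q p}"
  by (cases P) simp_all

lemma open_Collect_finite_Ball:
  assumes "finite A" "\<And>a. a \<in> A \<Longrightarrow> open {p. Q a p}"
  shows "open {p. \<forall>a\<in>A. Q a p}"
proof -
  have "{p. \<forall>a\<in>A. Q a p} = (\<Inter>a\<in>A. {p. Q a p})" by blast
  then show ?thesis using assms by (simp add: open_INT)
qed

lemma open_separated_cell: "open (separated_cell n (k::'m::finite) G)"
proof -
  have ex: "open {p. \<exists>i. i \<noteq> k \<and> endpoint p s a $ i \<noteq> (endpoint p s b $ i :: real)}" for s and a b :: nat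
  proof -
    have "{p. \<exists>i. i \<noteq> k \<and> endpoint p s a $ i \<noteq> (endpoint p s b $ i :: real)} =
        (\<Union>i\<in>-{k}. {p. endpoint p s a $ i \<noteq> endpoint p s b $ i})" by blast
    then show ?thesis by (simp only:) (intro open_UN ballI open_Collect_neq continuous_on_endpoint)
  qed
  have "separated_cell n k G = {p.
     (\<forall>s\<in>UNIV. \<forall>s'\<in>UNIV. \<forall>a\<in>{1..n}. \<forall>b\<in>{1..n}. \<forall>c\<in>{1..n}. \<forall>d\<in>{1..n}. (a, b) \<in> G s \<longrightarrow> (c, d) \<notin> G s' \<longrightarrow>
        \<bar>endpoint p s a $ k - endpoint p s b $ k\<bar> < \<bar>endpoint p s' c $ k - endpoint p s' d $ k\<bar>) \<and>
     (\<forall>s\<in>UNIV. \<forall>a\<in>{1..n}. \<forall>b\<in>{1..n}. (a, b) \<in> G s \<longrightarrow> a \<noteq> b \<longrightarrow> (\<exists>i. i \<noteq> k \<and> endpoint p s a $ i \<noteq> endpoint p s b $ i))}"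
    unfolding separated_cell_def by blast
  then show ?thesis
    by (simp only:) (intro open_Collect_conj open_Collect_finite_Ball open_Collect_const_imp ex finite_atLeastAtMost
        finite_class.finite_UNIV open_Collect_less continuous_on_rabs continuous_on_diff continuous_on_endpoint)
qed

text \<open>Sending a class of \<open>R\<close> to the class of \<open>S\<close> that contains it is
  surjective; equal finite cardinality makes it injective, so no two classes of \<open>R\<close> are
  merged.\<close>

lemma equiv_refine_card_eq:
  assumes fin: "finite A" and R: "equiv A R" and S: "equiv A S" and RS: "R \<subseteq> S" and c: "card (A // R) = card (A // S)"
  shows "R = S"
proof
  have im: "(\<lambda>X. S `` X) ` (A // R) = A // S" using refines_equiv_image_eq [OF RS R S] .
  have "finite (A // R)" using fin by (simp add: quotient_def)
  then have inj: "inj_on (\<lambda>X. S `` X) (A // R)"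
    using im c by (intro eq_card_imp_inj_on) auto
  show "S \<subseteq> R"
  proof
    fix q assume "q \<in> S"
    then obtain a b where q: "q = (a, b)" "(a, b) \<in> S" by (cases q) auto
    then have ab: "a \<in> A" "b \<in> A" using S by (auto simp: equiv_def refl_on_def)
    have "S `` (R `` {a}) = S `` (R `` {b})"
      using refines_equiv_class_eq2 [OF RS R S] equiv_class_eq [OF S q(2)] by simp
    then have "R `` {a} = R `` {b}" 
      by (rule inj_onD [OF inj]) (use ab in \<open>simp_all add: quotientI\<close>)
    then show "q \<in> R" unfolding q(1) by (rule eq_equiv_class [OF _ R ab(2)])
  qed
qed (rule RS)

text \<open>Unless one pair of relations contains the other componentwise, there are two indices
  related only by \<open>G\<close> and two related only by \<open>G'\<close>, and each difference
  would be smaller than the other. Under containment, equal totals of classes force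
  equality.\<close>

lemma separated_cell_disjoint:
  assumes p: "p \<in> separated_cell n k G" "p \<in> separated_cell n k G'"
    and G: "\<And>s. equiv {1..n} (G s)" and G': "\<And>s. equiv {1..n} (G' s)"
    and c: "card ({1..n} // G False) + card ({1..n} // G True) = card ({1..n} // G' False) + card ({1..n} // G' True)"
  shows "G = G'"
proof -
  have eq: "H = H'" if "\<And>s. H s \<subseteq> H' s" and H: "\<And>s. equiv {1..n} (H s)" "\<And>s. equiv {1..n} (H' s)"
    and c: "card ({1..n} // H False) + card ({1..n} // H True) = card ({1..n} // H' False) + card ({1..n} // H' True)"
    for H H' :: "bool \<Rightarrow> (nat \<times> nat) set"
  proof -
    have "finite ({1..n} // H s)" for s by (simp add: quotient_def)
    then have le: "card ({1..n} // H' s) \<le> card ({1..n} // H s)" for s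
      using finite_refines_card_le that(1) H by blast
    have "card ({1..n} // H s) = card ({1..n} // H' s)" for s
      using le [of False] le [of True] c by (cases s) auto
    then have "H s = H' s" for s
      using equiv_refine_card_eq [OF _ H that(1)] by simp
    then show ?thesis by blast
  qed
  have sub: "a \<in> {1..n} \<and> b \<in> {1..n}" if "(a, b) \<in> G s \<or> (a, b) \<in> G' s" for a b s
    using that G [of s] G' [of s] by (auto simp: equiv_def refl_on_def)
  have "(\<forall>s. G s \<subseteq> G' s) \<or> (\<forall>s. G' s \<subseteq> G s)"
  proof (rule ccontr)
    assume "\<not> ?thesis"
    then obtain s s' a b c d where *: "(a, b) \<in> G s" "(a, b) \<notin> G' s" "(c, d) \<in> G' s'" "(c, d) \<notin> G s'"
      by (auto simp: subset_iff)
    have "\<bar>endpoint p s a $ k - endpoint p s b $ k\<bar> < \<bar>endpoint p s' c $ k - endpoint p s' d $ k\<bar>"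
      using p(1) * sub unfolding separated_cell_def by blast
    moreover have "\<bar>endpoint p s' c $ k - endpoint p s' d $ k\<bar> < \<bar>endpoint p s a $ k - endpoint p s b $ k\<bar>"
      using p(2) * sub unfolding separated_cell_def by blast
    ultimately show False by linarith
  qed
  then show ?thesis using eq [of G G'] eq [of G' G] G G' c by metis
qed

text \<open>Relating points with equal coordinate \<open>k\<close> makes all differences within
  classes 0 and all others positive; related points, being distinct, differ in another
  coordinate.\<close>

lemma separated_cell_cover:
  fixes p :: "(nat \<Rightarrow> real ^ 'm::finite) \<times> (nat \<Rightarrow> real ^ 'm)" and k :: 'm
  assumes p: "p \<in> topspace (prod_topology (configuration_space n euclidean) (configuration_space n euclidean))"
  defines "G \<equiv> \<lambda>s. {(a, b). a \<in> {1..n} \<and> b \<in> {1..n} \<and> endpoint p s a $ k = endpoint p s b $ k}"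
  shows "p \<in> separated_cell n k G" "\<And>s. equiv {1..n} (G s)"
proof -
  show "equiv {1..n} (G s)" for s
    by (rule equivI) (auto simp: G_def refl_on_def sym_def trans_def)
  have "\<exists>i. i \<noteq> k \<and> endpoint p s a $ i \<noteq> endpoint p s b $ i"
    if "a \<in> {1..n}" "b \<in> {1..n}" "(a, b) \<in> G s" "a \<noteq> b" for s a b
  proof -
    have "endpoint p s \<in> topspace (configuration_space n euclidean)"
      using p by (cases s) (auto simp: endpoint_def)
    then have "endpoint p s a \<noteq> endpoint p s b" using that by (auto simp: topspace_configuration_space)
    then show ?thesis using that by (auto simp: vec_eq_iff G_def)
  qed
  then show "p \<in> separated_cell n k G"
    unfolding separated_cell_def by (auto simp: G_def)
qed

text \<open>Written as a sum of clamped increments, so that joint continuity in the time and the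
  vertices needs no case distinction.\<close>

definition polyline5 :: "(nat \<Rightarrow> 'v::real_vector) \<Rightarrow> real \<Rightarrow> 'v" where
  "polyline5 W t = W 0 + (\<Sum>i<5. max 0 (min 1 (5 * t - real i)) *\<^sub>R (W (Suc i) - W i))"

lemma polyline5_ends: "polyline5 W 0 = W 0" "polyline5 W 1 = W 5"
  by (simp_all add: polyline5_def eval_nat_numeral lessThan_Suc)

text \<open>The segment and the parameter on it depend on the time only, not on the vertices. So at
  every moment all points of a configuration are on the segment of the same number with the same
  parameter.\<close>

lemma polyline5_segment:
  assumes t: "0 \<le> t" "t \<le> 1"
  obtains i \<tau> where "i < 5" "0 \<le> \<tau>" "\<tau> \<le> 1"
    "\<And>W :: nat \<Rightarrow> 'v::real_vector. polyline5 W t = (1 - \<tau>) *\<^sub>R W i + \<tau> *\<^sub>R W (Suc i)"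
proof -
  define i where "i = (if t \<le> 1/5 then 0 else if t \<le> 2/5 then 1 else if t \<le> 3/5 then 2 else if t \<le> 4/5 then 3 else 4 :: nat)"
  have i: "i < 5" "real i \<le> 5 * t" "5 * t \<le> real i + 1" using t by (auto simp: i_def)
  have "polyline5 W t = (1 - (5 * t - real i)) *\<^sub>R W i + (5 * t - real i) *\<^sub>R W (Suc i)" for W :: "nat \<Rightarrow> 'v"
  proof -
    have tel: "(\<Sum>j<i. W (Suc j) - W j) = W i - W 0" by (simp add: sum_lessThan_telescope)
    have "(\<Sum>j<5. max 0 (min 1 (5 * t - real j)) *\<^sub>R (W (Suc j) - W j)) =
        (\<Sum>j<5. if j < i then W (Suc j) - W j else if j = i then (5 * t - real i) *\<^sub>R (W (Suc i) - W i) else 0)"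
    proof (rule sum.cong)
      fix j :: nat
      consider "j < i" | "j = i" | "i < j" by linarith
      then show "max 0 (min 1 (5 * t - real j)) *\<^sub>R (W (Suc j) - W j) =
          (if j < i then W (Suc j) - W j else if j = i then (5 * t - real i) *\<^sub>R (W (Suc i) - W i) else 0)"
      proof cases
        case 1
        then have "real j + 1 \<le> real i" by linarith
        then have "max 0 (min 1 (5 * t - real j)) = 1" using i by simp
        then show ?thesis using 1 by simp
      next
        case 2
        then show ?thesis using i by simp
      next
        case 3
        then have "real i + 1 \<le> real j" by linarith
        then have "max 0 (min 1 (5 * t - real j)) = 0" using i by simp
        then show ?thesis using 3 by simp
      qed
    qed simp
    also have "\<dots> = (\<Sum>j<i. W (Suc j) - W j) + (5 * t - real i) *\<^sub>R (W (Suc i) - W i)"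
    proof -
      have s: "{..<5} = {..<i} \<union> ({i} \<union> {i<..<5})" "{..<i} \<inter> ({i} \<union> {i<..<5}) = {}" "{i} \<inter> {i<..<5} = {}"
        using i by auto
      show ?thesis unfolding s(1)
        by (subst sum.union_disjoint) (use s in \<open>auto simp: sum.union_disjoint\<close>)
    qed
    finally show ?thesis
      unfolding polyline5_def tel by (simp add: algebra_simps)
  qed
  with i that [of i "5 * t - real i"] show thesis by simp
qed

text \<open>The sum counts the points whose first coordinate is smaller, ignoring pairs in the same class.
  It is continuous where the pairs in different classes have different first coordinates.\<close>
definition level :: "nat \<Rightarrow> 'm \<Rightarrow> (nat \<times> nat) set \<Rightarrow> (nat \<Rightarrow> real ^ 'm) \<Rightarrow> nat \<Rightarrow> real" where
  "level n k E x a = real a + (real n + 1) *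
     (\<Sum>c\<in>{1..n}. if (a, c) \<in> E then 0 else (1 + sgn (x a $ k - x c $ k)) / 2)"

context
  fixes n :: nat and k :: "'m::finite" and E :: "(nat \<times> nat) set" and x :: "nat \<Rightarrow> real ^ 'm"
  assumes E: "equiv {1..n} E"
    and sep: "\<And>a b c d. \<lbrakk>a \<in> {1..n}; b \<in> {1..n}; c \<in> {1..n}; d \<in> {1..n}; (a, b) \<in> E; (c, d) \<notin> E\<rbrakk> \<Longrightarrow>
        \<bar>x a $ k - x b $ k\<bar> < \<bar>x c $ k - x d $ k\<bar>"
begin

lemma separated_diff_nonzero:
  assumes "a \<in> {1..n}" "b \<in> {1..n}" "(a, b) \<notin> E"
  shows "x a $ k - x b $ k \<noteq> 0"
proof -
  have "(a, a) \<in> E" using E assms by (auto simp: equiv_def refl_on_def)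
  then show ?thesis using sep [of a a a b] assms by auto
qed

text \<open>Every point counted for \<open>a\<close> is counted for \<open>b\<close>, and
  \<open>a\<close> itself is counted for \<open>b\<close> only. The factor \<open>n + 1\<close>
  makes this gain outweigh the difference of the indices.\<close>

lemma level_strict_mono:
  assumes ab: "a \<in> {1..n}" "b \<in> {1..n}" "(a, b) \<notin> E" "x a $ k < x b $ k"
  shows "level n k E x a < level n k E x b"
proof -
  let ?t = "\<lambda>a c. if (a, c) \<in> E then 0 else (1 + sgn (x a $ k - x c $ k)) / 2"
  have refl: "(a, a) \<in> E" and ba: "(b, a) \<notin> E"
    using E ab by (auto simp: equiv_def refl_on_def sym_def)
  have le: "?t a c \<le> ?t b c" if c: "c \<in> {1..n}" for c
  proof (cases "(a, c) \<in> E \<or> x a $ k < x c $ k")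
    case True
    then have "?t a c = 0" by auto
    moreover have "?t b c \<ge> 0" by (auto simp: sgn_if)
    ultimately show ?thesis by simp
  next
    case False
    then have ac: "x c $ k < x a $ k" using separated_diff_nonzero [OF ab(1) c] by auto
    \<comment> \<open>Here \<open>c\<close> lies below \<open>a\<close> and \<open>a\<close> below
      \<open>b\<close>. If \<open>b\<close> and \<open>c\<close> shared a class, their difference
      would have to be less than that of the unrelated \<open>a\<close> and
      \<open>b\<close>.\<close>
    have "(b, c) \<notin> E"
    proof
      assume "(b, c) \<in> E"
      then have "\<bar>x b $ k - x c $ k\<bar> < \<bar>x a $ k - x b $ k\<bar>" using sep ab c by blast
      then show False using ac ab by linarith
    qed
    then show ?thesis using ac ab False by (auto simp: sgn_if)
  qed
  have "(\<Sum>c\<in>{1..n}. ?t a c) + 1 = ?t a a + (\<Sum>c\<in>{1..n} - {a}. ?t a c) + 1"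
    using ab by (subst sum.remove [of _ a]) auto
  also have "\<dots> \<le> ?t b a + (\<Sum>c\<in>{1..n} - {a}. ?t b c)"
  proof -
    have "(\<Sum>c\<in>{1..n} - {a}. ?t a c) \<le> (\<Sum>c\<in>{1..n} - {a}. ?t b c)"
      by (rule sum_mono) (rule le, simp)
    moreover have "?t a a = 0" "?t b a = 1" using refl ba ab by (simp_all add: sgn_if)
    ultimately show ?thesis by linarith
  qed
  also have "\<dots> = (\<Sum>c\<in>{1..n}. ?t b c)"
    using ab by (subst (2) sum.remove [of _ a]) auto
  finally have "(real n + 1) * ((\<Sum>c\<in>{1..n}. ?t a c) + 1) \<le> (real n + 1) * (\<Sum>c\<in>{1..n}. ?t b c)"
    by (intro mult_left_mono) auto
  moreover have "real a < real b + (real n + 1)" using ab by simp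
  ultimately show ?thesis unfolding level_def by (simp add: algebra_simps)
qed

text \<open>The counts are integers, so a level determines its index modulo \<open>n + 1\<close>,
  and the indices lie in \<open>{1..n}\<close>.\<close>

lemma level_inj:
  assumes ab: "a \<in> {1..n}" "b \<in> {1..n}" "a \<noteq> b"
  shows "level n k E x a \<noteq> level n k E x b"
proof
  assume eq: "level n k E x a = level n k E x b"
  let ?t = "\<lambda>a c. if (a, c) \<in> E then 0 else (1 + sgn (x a $ k - x c $ k)) / 2"
  have int: "(\<Sum>c\<in>{1..n}. ?t a c) \<in> \<int>" if "a \<in> {1..n}" for a
  proof (rule Ints_sum)
    fix c assume "c \<in> {1..n}"
    then show "?t a c \<in> \<int>" using separated_diff_nonzero [OF that] by (auto simp: sgn_if)
  qed
  have "(\<Sum>c\<in>{1..n}. ?t b c) - (\<Sum>c\<in>{1..n}. ?t a c) \<in> \<int>" using int ab by (intro Ints_diff)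
  then obtain K where K: "(\<Sum>c\<in>{1..n}. ?t b c) - (\<Sum>c\<in>{1..n}. ?t a c) = of_int K" by (elim Ints_cases)
  have "real a - real b = (real n + 1) * ((\<Sum>c\<in>{1..n}. ?t b c) - (\<Sum>c\<in>{1..n}. ?t a c))"
    using eq unfolding level_def by (simp add: algebra_simps)
  then have "real_of_int (int a - int b) = real_of_int ((int n + 1) * K)" unfolding K by simp
  then have i: "int a - int b = (int n + 1) * K" by (simp only: of_int_eq_iff)
  then have "(int n + 1) dvd (int a - int b)" by simp
  then have "int a - int b = 0"
    using ab zdvd_imp_le [of "int n + 1" "int a - int b"] zdvd_imp_le [of "int n + 1" "int b - int a"]
    by (smt (verit) atLeastAtMost_iff dvd_minus_iff minus_diff_eq of_nat_le_iff of_nat_0_le_iff of_nat_1)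
  then show False using ab by simp
qed

end

text \<open>Vertices of the route: spread the points in coordinate \<open>k\<close> by their levels;
  put the index into coordinate \<open>l\<close> and 0 elsewhere; change the levels of the start
  into those of the goal; undo the first two stages at the goal. Vertices 0 to 2 belong to the
  start, 3 to 5 to the goal.\<close>

definition waypoint :: "nat \<Rightarrow> 'm \<Rightarrow> 'm \<Rightarrow> (bool \<Rightarrow> (nat \<times> nat) set) \<Rightarrow> (nat \<Rightarrow> real ^ 'm) \<times> (nat \<Rightarrow> real ^ 'm)
    \<Rightarrow> nat \<Rightarrow> nat \<Rightarrow> real ^ 'm::finite" where
  "waypoint n k l G p a i =
     (if i = 0 then fst p a else if i = 5 then snd p a
      else (let s = (i > 2); f = level n k (G s) (endpoint p s) a
        in if i = 1 \<or> i = 4 then (\<chi> j. if j = k then f else endpoint p s a $ j)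
           else (\<chi> j. if j = k then f else if j = l then real a else 0)))"

section \<open>The planner on one cell\<close>

lemma continuous_on_polyline5:
  fixes W :: "'z::topological_space \<Rightarrow> nat \<Rightarrow> 'v::real_normed_vector"
  assumes "\<And>i. i \<le> 5 \<Longrightarrow> continuous_on S (\<lambda>z. W z i)"
  shows "continuous_on (S \<times> {0..1}) (\<lambda>z. polyline5 (W (fst z)) (snd z))"
proof -
  have "continuous_on (S \<times> {0..1}) (\<lambda>z. W (fst z) i)" if "i \<le> 5" for i
    by (rule continuous_on_compose2 [OF assms [OF that]]) (auto intro: continuous_intros)
  then show ?thesis
    unfolding polyline5_def by (intro continuous_intros) auto
qed

lemma separated_cellD:
  assumes "p \<in> separated_cell n k G"
  shows "\<lbrakk>a \<in> {1..n}; b \<in> {1..n}; c \<in> {1..n}; d \<in> {1..n}; (a, b) \<in> G s; (c, d) \<notin> G s\<rbrakk> \<Longrightarrow>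
        \<bar>endpoint p s a $ k - endpoint p s b $ k\<bar> < \<bar>endpoint p s c $ k - endpoint p s d $ k\<bar>"
    and "\<lbrakk>a \<in> {1..n}; b \<in> {1..n}; (a, b) \<in> G s; a \<noteq> b\<rbrakk> \<Longrightarrow> \<exists>i. i \<noteq> k \<and> endpoint p s a $ i \<noteq> endpoint p s b $ i"
  using assms unfolding separated_cell_def by blast+

text \<open>The sign function is discontinuous only at 0, and on the cell the differences of
  unrelated points do not vanish.\<close>

lemma continuous_on_level:
  assumes G: "equiv {1..n} (G s)" and a: "a \<in> {1..n}"
  shows "continuous_on (separated_cell n k G) (\<lambda>p. level n k (G s) (endpoint p s) a)"
proof -
  have "continuous_on (separated_cell n k G) (\<lambda>p. if (a, c) \<in> G s then 0
      else (1 + sgn (endpoint p s a $ k - endpoint p s c $ k)) / 2)" if c: "c \<in> {1..n}" for c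
  proof (cases "(a, c) \<in> G s")
    case False
    have "endpoint p s a $ k - endpoint p s c $ k \<noteq> 0" if "p \<in> separated_cell n k G" for p
      by (rule separated_diff_nonzero [OF G separated_cellD(1) [OF that] a c False])
    then have "continuous_on (separated_cell n k G) (\<lambda>p. (1 + sgn (endpoint p s a $ k - endpoint p s c $ k)) / 2)"
      by (intro continuous_on_divide continuous_on_add continuous_on_const continuous_on_sgn continuous_on_diff
          continuous_on_endpoint) auto
    then show ?thesis using False by simp
  qed simp
  then show ?thesis unfolding level_def by (intro continuous_intros)
qed

lemma continuous_on_waypoint:
  fixes k l :: "'m::finite"
  assumes G: "\<And>s. equiv {1..n} (G s)" and a: "a \<in> {1..n}"
  shows "continuous_on (separated_cell n k G) (\<lambda>p. waypoint n k l G p a i)"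
proof -
  have e01: "continuous_on S (\<lambda>p. fst p a)" "continuous_on S (\<lambda>p. snd p a)"
    for S :: "((nat \<Rightarrow> real ^ 'm) \<times> (nat \<Rightarrow> real ^ 'm)) set"
    by (rule continuous_on_product_then_coordinatewise [OF continuous_on_fst [OF continuous_on_id]]
        continuous_on_product_then_coordinatewise [OF continuous_on_snd [OF continuous_on_id]])+
  let ?s = "i > 2"
  have "continuous_on (separated_cell n k G) (\<lambda>p. if j = k then level n k (G ?s) (endpoint p ?s) a else endpoint p ?s a $ j)" for j
    using continuous_on_level [OF G a] continuous_on_endpoint by (cases "j = k") simp_all
  moreover have "continuous_on (separated_cell n k G) (\<lambda>p. if j = k then level n k (G ?s) (endpoint p ?s) a
      else if j = l then real a else 0)" for j
    using continuous_on_level [OF G a] by (cases "j = k") simp_all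
  ultimately show ?thesis
    unfolding waypoint_def Let_def using e01
    by (cases "i = 0"; cases "i = 5"; cases "i = 1 \<or> i = 4"; simp only: if_True if_False simp_thms; intro continuous_on_vec_lambda)
      assumption?
qed

text \<open>Points in different classes keep their order in coordinate \<open>k\<close>, because the
  levels are ordered in the same way. Points in the same class keep a difference in another
  coordinate, which the straightening does not touch.\<close>

lemma straightening_injective:
  assumes G: "equiv {1..n} (G s)" and p: "p \<in> separated_cell n k G"
    and ab: "a \<in> {1..n}" "b \<in> {1..n}" "a \<noteq> b" and \<sigma>: "0 \<le> \<sigma>" "\<sigma> \<le> 1"
  defines "q \<equiv> \<lambda>a. (1 - \<sigma>) *\<^sub>R endpoint p s a +
      \<sigma> *\<^sub>R (\<chi> j. if j = k then level n k (G s) (endpoint p s) a else endpoint p s a $ j)"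
  shows "q a \<noteq> q b"
proof -
  let ?x = "endpoint p s" and ?f = "level n k (G s) (endpoint p s)"
  have less: "q c $ k < q d $ k" if "?x c $ k < ?x d $ k" "c \<in> {1..n}" "d \<in> {1..n}" "(c, d) \<notin> G s" for c d
  proof -
    have "?f c < ?f d"
      by (rule level_strict_mono [where x = ?x and E = "G s", OF G separated_cellD(1) [OF p]]) (use that in auto)
    then have "(1 - \<sigma>) * ?x c $ k + \<sigma> * ?f c < (1 - \<sigma>) * ?x d $ k + \<sigma> * ?f d"
    proof (cases "\<sigma> = 0")
      case False
      have "(1 - \<sigma>) * ?x c $ k \<le> (1 - \<sigma>) * ?x d $ k" using that(1) \<sigma> by (intro mult_left_mono) auto
      moreover have "\<sigma> * ?f c < \<sigma> * ?f d" using \<open>?f c < ?f d\<close> False \<sigma> by simp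
      ultimately show ?thesis by linarith
    qed (use that(1) in simp)
    then show ?thesis by (simp add: q_def)
  qed
  show ?thesis
  proof (cases "(a, b) \<in> G s")
    case True
    then obtain i where i: "i \<noteq> k" "?x a $ i \<noteq> ?x b $ i" using separated_cellD(2) [OF p ab(1,2)] ab by blast
    have "q c $ i = ?x c $ i" for c using i(1) by (simp add: q_def algebra_simps)
    then show ?thesis using i by metis
  next
    case False
    then have F: "(b, a) \<notin> G s" using G by (auto simp: equiv_def sym_def)
    have "?x a $ k - ?x b $ k \<noteq> 0"
      by (rule separated_diff_nonzero [OF G separated_cellD(1) [OF p] ab(1,2) False])
    then show ?thesis using less [of a b] less [of b a] False F ab by (metis diff_self less_irrefl linorder_neqE_linordered_idom)
  qed
qed

text \<open>The points are kept apart by the straightening on the two outer segments, by distinct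
  levels in coordinate \<open>k\<close> on the second and fourth, and by the index in coordinate
  \<open>l\<close> on the middle one.\<close>

lemma waypoint_segment_injective:
  assumes G: "\<And>s. equiv {1..n} (G s)" and p: "p \<in> separated_cell n k G" and kl: "k \<noteq> l"
    and ab: "a \<in> {1..n}" "b \<in> {1..n}" "a \<noteq> b" and \<tau>: "0 \<le> \<tau>" "\<tau> \<le> 1" and i: "i < 5"
  shows "(1 - \<tau>) *\<^sub>R waypoint n k l G p a i + \<tau> *\<^sub>R waypoint n k l G p a (Suc i) \<noteq>
         (1 - \<tau>) *\<^sub>R waypoint n k l G p b i + \<tau> *\<^sub>R waypoint n k l G p b (Suc i)" (is "?q a \<noteq> ?q b")
proof -
  consider "i = 0" | "i = 1" | "i = 2" | "i = 3" | "i = 4" using i by linarith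
  then show ?thesis
  proof cases
    case 1
    then show ?thesis
      using straightening_injective [of n G False, OF G p ab \<tau>] by (simp add: waypoint_def endpoint_def cong: if_cong)
  next
    case 2
    have "?q c $ k = level n k (G False) (endpoint p False) c" for c
      using 2 by (simp add: waypoint_def algebra_simps)
    moreover have "level n k (G False) (endpoint p False) a \<noteq> level n k (G False) (endpoint p False) b"
      by (rule level_inj [where E = "G False", OF G separated_cellD(1) [OF p] ab])
    ultimately show ?thesis by metis
  next
    case 3
    have "?q c $ l = real c" for c
      using 3 kl by (simp add: waypoint_def algebra_simps)
    then show ?thesis using ab by (metis of_nat_eq_iff)
  next
    case 4
    have "?q c $ k = level n k (G True) (endpoint p True) c" for c
      using 4 by (simp add: waypoint_def algebra_simps)
    moreover have "level n k (G True) (endpoint p True) a \<noteq> level n k (G True) (endpoint p True) b"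
      by (rule level_inj [where E = "G True", OF G separated_cellD(1) [OF p] ab])
    ultimately show ?thesis by metis
  next
    case 5
    \<comment> \<open>The last segment is the straightening of the goal run backwards.\<close>
    have "0 \<le> 1 - \<tau>" "1 - \<tau> \<le> 1" using \<tau> by auto
    from straightening_injective [of n G True, OF G p ab this] 5 show ?thesis
      by (simp add: waypoint_def endpoint_def add.commute cong: if_cong)
  qed
qed

lemma local_motion_planner_separated_cell:
  fixes n :: nat and k l :: "'m::finite" and G :: "bool \<Rightarrow> (nat \<times> nat) set"
  defines "X \<equiv> configuration_space n (euclidean :: (real ^ 'm) topology)"
  assumes G: "\<And>s. equiv {1..n} (G s)" and kl: "k \<noteq> l"
  shows "local_motion_planner X (topspace (prod_topology X X) \<inter> separated_cell n k G)
     (\<lambda>p. \<lambda>t\<in>{0..1}. \<lambda>a\<in>{1..n}. polyline5 (waypoint n k l G p a) t)"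
proof -
  let ?C = "separated_cell n k G"
  let ?Z = "subtopology (prod_topology X X) ?C"
  let ?P = "prod_topology ?Z (top_of_set {0..1::real})"
  define g where "g = (\<lambda>(p, t). \<lambda>a\<in>{1..n}. polyline5 (waypoint n k l G p a) t)"
  have id: "continuous_map ?P (top_of_set (?C \<times> {0..1})) (\<lambda>z. z)"
  proof -
    have "continuous_map ?Z (top_of_set ?C) (\<lambda>p. p)"
      unfolding X_def continuous_map_in_subtopology
      by (auto intro: continuous_map_from_subtopology continuous_map_configuration_pairs_euclidean)
    then have "continuous_map ?P (prod_topology (top_of_set ?C) (top_of_set {0..1})) (\<lambda>z. (fst z, snd z))"
      using continuous_map_compose [OF continuous_map_fst, of ?Z "top_of_set ?C" "\<lambda>p. p"]
      by (intro continuous_map_pairedI continuous_map_snd) (simp add: o_def)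
    then show ?thesis by simp
  qed
  have gc: "continuous_map ?P X g"
    unfolding X_def
  proof (rule continuous_map_into_configuration_space)
    fix z assume "z \<in> topspace (prod_topology (subtopology (prod_topology (configuration_space n euclidean)
       (configuration_space n euclidean)) ?C) (top_of_set {0..1::real}))"
    then obtain p t where z: "z = (p, t)" and p: "p \<in> ?C" and t: "0 \<le> t" "t \<le> 1" by auto
    have "polyline5 (waypoint n k l G p a) t \<noteq> polyline5 (waypoint n k l G p b) t"
      if ab: "a \<in> {1..n}" "b \<in> {1..n}" "a \<noteq> b" for a b
    proof -
      obtain i \<tau> where "i < 5" "0 \<le> \<tau>" "\<tau> \<le> 1"
        and "\<And>W :: nat \<Rightarrow> real ^ 'm. polyline5 W t = (1 - \<tau>) *\<^sub>R W i + \<tau> *\<^sub>R W (Suc i)"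
        using polyline5_segment [OF t] by blast
      then show ?thesis using waypoint_segment_injective [OF G p kl ab] by metis
    qed
    then show "g z \<in> topspace (configuration_space n euclidean)"
      by (auto simp: z g_def topspace_configuration_space)
  next
    fix a assume a: "a \<in> {1..n}"
    have "continuous_on (?C \<times> {0..1}) (\<lambda>z. polyline5 (waypoint n k l G (fst z) a) (snd z))"
      by (intro continuous_on_polyline5 continuous_on_waypoint G a)
    then have "continuous_map (top_of_set (?C \<times> {0..1})) euclidean (\<lambda>z. polyline5 (waypoint n k l G (fst z) a) (snd z))"
      by simp
    from continuous_map_compose [OF id this]
    show "continuous_map (prod_topology (subtopology (prod_topology (configuration_space n euclidean)
       (configuration_space n euclidean)) ?C) (top_of_set {0..1::real})) euclidean (\<lambda>z. g z a)"
      using a by (simp add: g_def case_prod_unfold o_def X_def)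
  qed
  from continuous_map_path_space_curry [OF gc]
  have "continuous_map ?Z (path_space X) (\<lambda>p. \<lambda>t\<in>{0..1}. \<lambda>a\<in>{1..n}. polyline5 (waypoint n k l G p a) t)"
    by (simp add: g_def)
  then have "continuous_map (subtopology (prod_topology X X) (topspace (prod_topology X X) \<inter> ?C)) (path_space X)
      (\<lambda>p. \<lambda>t\<in>{0..1}. \<lambda>a\<in>{1..n}. polyline5 (waypoint n k l G p a) t)"
    by (metis subtopology_restrict)
  moreover have "path_ends (\<lambda>t\<in>{0..1}. \<lambda>a\<in>{1..n}. polyline5 (waypoint n k l G p a) t) = p"
    if "p \<in> topspace (prod_topology X X)" for p
  proof -
    \<comment> \<open>Restriction to \<open>{1..n}\<close> changes nothing at the ends, as
      configurations are extensional.\<close>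
    have "restrict (fst p) {1..n} = fst p" "restrict (snd p) {1..n} = snd p"
      using that by (auto simp: X_def topspace_configuration_space extensional_restrict)
    then show ?thesis
      by (simp add: path_ends_def polyline5_ends waypoint_def)
  qed
  ultimately show ?thesis
    unfolding local_motion_planner_def by blast
qed

section \<open>Assembling the cover\<close>

lemma card_quotient_bounds:
  assumes "equiv {1..n} E" "n \<ge> 1"
  shows "1 \<le> card ({1..n} // E)" "card ({1..n} // E) \<le> n"
proof -
  have q: "{1..n} // E = (\<lambda>a. E `` {a}) ` {1..n}" by (auto simp: quotient_def)
  show "card ({1..n} // E) \<le> n" unfolding q using card_image_le [of "{1..n}"] by simp
  have "{1..n} // E \<noteq> {}" "finite ({1..n} // E)" unfolding q using assms(2) by auto
  then show "1 \<le> card ({1..n} // E)" by (simp add: Suc_leI card_gt_0_iff)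
qed

lemma motion_planning_cover_configuration_space:
  assumes n: "n \<ge> 1" and m: "CARD('m::finite) \<ge> 2"
  shows "motion_planning_cover (configuration_space n (euclidean :: (real ^ 'm) topology)) (2 * n - 1)"
proof -
  define X where "X = configuration_space n (euclidean :: (real ^ 'm) topology)"
  let ?P = "prod_topology X X"
  obtain k l :: 'm where kl: "k \<noteq> l"
    using m by (metis card_le_Suc0_iff_eq finite_class.finite_UNIV not_less_eq_eq numeral_2_eq_2)
  define num_classes where "num_classes G = card ({1..n} // G False) + card ({1..n} // G True)" for G
  \<comment> \<open>The totals run from 2 to \<open>2 * n\<close>; the shift by 1 turns them into
    the indices 1 to \<open>2 * n - 1\<close>.\<close>
  define I where "I c = {G. (\<forall>s. equiv {1..n} (G s)) \<and> num_classes G = c + 1}" for c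
  define T where "T G = topspace ?P \<inter> separated_cell n k G" for G
  define U where "U c = (\<Union>G\<in>I c. T G)" for c
  have T: "openin ?P (T G)" for G
    using openin_continuous_map_preimage [OF continuous_map_configuration_pairs_euclidean, of "separated_cell n k G" n]
      open_separated_cell [of n k G]
    by (simp add: T_def X_def Int_def)
  have disj: "G = G'" if "G \<in> I c" "G' \<in> I c" "p \<in> T G" "p \<in> T G'" for G G' c p
    using that by (intro separated_cell_disjoint [of p n k]) (auto simp: I_def T_def num_classes_def)
  have "\<exists>s. local_motion_planner X (U c) s" for c
  proof -
    define s where "s G p = (\<lambda>t\<in>{0..1}. \<lambda>a\<in>{1..n}. polyline5 (waypoint n k l G p a) t)" for G p
    have lp: "local_motion_planner X (T G) (s G)" if "G \<in> I c" for G
      using that local_motion_planner_separated_cell [OF _ kl, of n G]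
      unfolding T_def X_def s_def I_def by blast
    let ?S = "subtopology ?P (U c)"
    have sub: "subtopology ?S (T G) = subtopology ?P (T G)" if "G \<in> I c" for G
    proof -
      have "U c \<inter> T G = T G" using that by (auto simp: U_def)
      then show ?thesis by (simp add: subtopology_subtopology)
    qed
    obtain g where g: "continuous_map ?S (path_space X) g"
      and gs: "\<And>p G. \<lbrakk>G \<in> I c; p \<in> topspace ?S \<inter> T G\<rbrakk> \<Longrightarrow> g p = s G p"
    proof (rule pasting_lemma_exists [where X = ?S and I = "I c" and T = T and Y = "path_space X" and f = s])
      show "topspace ?S \<subseteq> (\<Union>G\<in>I c. T G)" by (auto simp: U_def)
      show "openin ?S (T G)" if "G \<in> I c" for G
        unfolding openin_subtopology using T [of G] that by (intro exI [of _ "T G"]) (auto simp: U_def)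
      show "continuous_map (subtopology ?S (T G)) (path_space X) (s G)" if "G \<in> I c" for G
        using lp [OF that] sub [OF that] by (simp add: local_motion_planner_def)
      \<comment> \<open>Distinct cells of the same total do not meet, so agreement on overlaps is
        trivial.\<close>
      show "s G p = s G' p" if "G \<in> I c" "G' \<in> I c" "p \<in> topspace ?S \<inter> T G \<inter> T G'" for G G' p
        using disj that by blast
    qed blast
    have "path_ends (g p) = p" if pU: "p \<in> U c" for p
    proof -
      obtain G where G: "G \<in> I c" "p \<in> T G" using pU by (auto simp: U_def)
      then have "g p = s G p" using pU by (intro gs) (auto simp: T_def)
      then show ?thesis using lp [OF G(1)] G(2) by (simp add: local_motion_planner_def)
    qed
    with g show ?thesis unfolding local_motion_planner_def by blast
  qed
  moreover have "openin ?P (U c)" for c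
    unfolding U_def using T by (intro openin_Union) auto
  moreover have "(\<Union>c\<in>{1..2 * n - 1}. U c) = topspace ?P"
  proof
    show "(\<Union>c\<in>{1..2 * n - 1}. U c) \<subseteq> topspace ?P" by (auto simp: U_def T_def)
    show "topspace ?P \<subseteq> (\<Union>c\<in>{1..2 * n - 1}. U c)"
    proof
      fix p assume p: "p \<in> topspace ?P"
      obtain G where G: "p \<in> separated_cell n k G" "\<And>s. equiv {1..n} (G s)"
        using separated_cell_cover [OF p [unfolded X_def], where k = k] by blast
      define c where "c = num_classes G - 1"
      have "1 \<le> card ({1..n} // G s)" "card ({1..n} // G s) \<le> n" for s
        using card_quotient_bounds [OF G(2) n] by blast+
      from this [of False] this [of True]
      have "c \<in> {1..2 * n - 1}" "num_classes G = c + 1" by (auto simp: c_def num_classes_def)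
      moreover from this have "p \<in> U c" using G p by (auto simp: U_def T_def I_def)
      ultimately show "p \<in> (\<Union>c\<in>{1..2 * n - 1}. U c)" by blast
    qed
  qed
  ultimately show ?thesis
    unfolding motion_planning_cover_def X_def [symmetric] by blast
qed

theorem mainTheorem5:
  fixes n :: nat
  assumes "n \<ge> 1"
    and "CARD('m::finite) \<ge> 3"
    and "odd CARD('m)"
  shows "topological_complexity (configuration_space n (euclidean :: (real ^ 'm) topology))
           = enat (2 * n - 1)"
proof (rule antisym)
  let ?X = "configuration_space n (euclidean :: (real ^ 'm) topology)"
  have "motion_planning_cover ?X (2 * n - 1)"
    using assms by (intro motion_planning_cover_configuration_space) auto
  then show "topological_complexity ?X \<le> enat (2 * n - 1)"
    unfolding topological_complexity_def by (intro INF_lower) simp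
  have "2 * n - 1 \<le> k" if k: "motion_planning_cover ?X k" for k
  proof (cases "n = 1")
    case True
    \<comment> \<open>With a single point there is no sphere factor for the degree argument; the
      bound 1 only says that a nonempty space is not covered by an empty family.\<close>
    have "(\<lambda>i\<in>{1..n}. 0) \<in> topspace ?X"
      using True by (auto simp: topspace_configuration_space)
    then have ne: "topspace (prod_topology ?X ?X) \<noteq> {}" unfolding topspace_prod_topology by blast
    obtain U where "(\<Union>i\<in>{1..k}. U i) = topspace (prod_topology ?X ?X)"
      using k unfolding motion_planning_cover_def by blast
    then have "{1..k} \<noteq> {}" using ne by (metis UN_empty)
    then show ?thesis using True by simp
  next
    case False
    then show ?thesis
      using motion_planning_cover_configuration_space_ge [OF _ assms(3) k] assms(1) by simp
  qed
  then show "enat (2 * n - 1) \<le> topological_complexity ?X"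
    unfolding topological_complexity_def by (intro INF_greatest) simp
qed

end
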